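(* Let $\mathcal{L}$ be a finite relational language and $T_\forall$ a universal $\mathcal{L}$-theory such that the class of finite models of $T_\forall$ is a Fraïssé class with the Strong Amalgamation Property, and let $T^*$ be the theory of the Fraïssé limit of the class of finite models of $T^*_\forall$ (as defined in the context). Let $M\models T^*$ with monster model $\mathfrak{C}$, let $B$ be a branch (maximal chain) of $M$, let $q_T(x)$ be the unique complete type over $M$ determined by $\{x>b : b\in B\}$, let $c\in\mathfrak{C}$ realize $q_T$, and let $\pi_T(x)=q_T(x)\cup\{x<c\}$. Then $\pi_T(x)$ does not fork over $M$, and moreover it is finitely satisfiable in $M$ (in fact in $B$).
   Context: A Fraïssé class is a class of finitely generated structures with the hereditary property (HP), joint embedding property (JEP) and amalgamation property (AP). It has the Strong Amalgamation Property (SAP) if in AP, for embeddings $f_1:A\to B$, $f_2:A\to C$ the amalgamating embeddings $g_1:B\to D$, $g_2:C\to D$ ($g_1f_1=g_2f_2$) can be chosen with $\mathrm{Im}(g_1)\cap\mathrm{Im}(g_2)=\mathrm{Im}(g_2 f_2)$, and in JEP the images of the two structures can be chosen disjoint. Trees: $\mathcal{L}_{Tr}=\{\leq,\wedge\}$, and $Tr$ is the theory of meet-trees: $\leq$ is a partial order such that $\{y : y\leq x\}$ is linearly ordered for every $x$, and $x\wedge y$ is the greatest element of $\{z : z\leq x,y\}$. The theory $T^*_\forall$: for each $n$-place relation symbol $R\in\mathcal{L}$ let $R^*$ be an $(n+1)$-place relation symbol, and let $\mathcal{L}^*=\mathcal{L}_{Tr}\cup\{R^* : R\in\mathcal{L}\}$.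 Let $=^*(x,y,y')$ stand for $x<y\wedge y'$. For a quantifier-free $\mathcal{L}$-formula $\psi(y)$ ($y$ a tuple), $\psi^*(x,y)$ is obtained from $\psi$ by replacing each atomic formula $R(\dots)$ (including equality) by $R^*(x,\dots)$. $T^*_\forall$ consists of the axioms of $Tr$; for each $n$-place $R\in\mathcal{L}$ the axioms (WD) $\forall x,y_0,\dots,y_{n-1},y'_0,\dots,y'_{n-1}\,\big(R^*(x,y_0,\dots,y_{n-1})\ \&\ x<y_i\wedge y'_i \text{ for all } i<n\big)\to R^*(x,y'_0,\dots,y'_{n-1})$, and (OC) $\forall x,y_0,\dots,y_{n-1}\, R^*(x,y_0,\dots,y_{n-1})\to x<y_i$ for all $i<n$; and for each axiom $\forall y\,\psi(y)$ of $T_\forall$ the axiom $\forall x,y\,(x<y\to\psi^*(x,y))$, where $x<y$ means that $x$ is smaller than every variable in $y$. The finite models of $T^*_\forall$ form a uniformly locally finite Fraïssé class, and $T^*$ is the theory of its Fraïssé limit (equivalently, the model completion of $T^*_\forall$; it has quantifier elimination). The partial type $\{x>b : b\in B\}$ determines a unique complete type over $M$. *)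

theory Defs
  imports Main
begin

section \<open>First-order languages and structures\<close>

text \<open>Symbols are given with their arities by partial maps; a symbol belongs to the language
  iff it is in the domain. Formulas use named variables.\<close>

record ('f, 'r) lang =
  fun_ar :: "'f \<Rightarrow> nat option"
  rel_ar :: "'r \<Rightarrow> nat option"

datatype 'f trm = Var nat | Fun 'f "'f trm list"

datatype ('f, 'r) fm =
    Fls
  | Eq "'f trm" "'f trm"
  | Rel 'r "'f trm list"
  | Neg "('f, 'r) fm"
  | Conj "('f, 'r) fm" "('f, 'r) fm"
  | Forall nat "('f, 'r) fm"

abbreviation Disj :: "('f, 'r) fm \<Rightarrow> ('f, 'r) fm \<Rightarrow> ('f, 'r) fm" where
  "Disj \<phi> \<psi> \<equiv> Neg (Conj (Neg \<phi>) (Neg \<psi>))"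

abbreviation Imp :: "('f, 'r) fm \<Rightarrow> ('f, 'r) fm \<Rightarrow> ('f, 'r) fm" where
  "Imp \<phi> \<psi> \<equiv> Neg (Conj \<phi> (Neg \<psi>))"

definition Conjs :: "('f, 'r) fm list \<Rightarrow> ('f, 'r) fm" where
  "Conjs \<phi>s = foldr Conj \<phi>s (Neg Fls)"

definition Foralls :: "nat list \<Rightarrow> ('f, 'r) fm \<Rightarrow> ('f, 'r) fm" where
  "Foralls xs \<phi> = foldr Forall xs \<phi>"

fun fv_trm :: "'f trm \<Rightarrow> nat set" where
  "fv_trm (Var n) = {n}"
| "fv_trm (Fun f ts) = (\<Union>t\<in>set ts. fv_trm t)"

fun fv :: "('f, 'r) fm \<Rightarrow> nat set" where
  "fv Fls = {}"
| "fv (Eq s t) = fv_trm s \<union> fv_trm t"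
| "fv (Rel R ts) = (\<Union>t\<in>set ts. fv_trm t)"
| "fv (Neg \<phi>) = fv \<phi>"
| "fv (Conj \<phi> \<psi>) = fv \<phi> \<union> fv \<psi>"
| "fv (Forall n \<phi>) = fv \<phi> - {n}"

fun wf_trm :: "('f, 'r) lang \<Rightarrow> 'f trm \<Rightarrow> bool" where
  "wf_trm L (Var n) \<longleftrightarrow> True"
| "wf_trm L (Fun f ts) \<longleftrightarrow> fun_ar L f = Some (length ts) \<and> (\<forall>t\<in>set ts. wf_trm L t)"

fun wf_fm :: "('f, 'r) lang \<Rightarrow> ('f, 'r) fm \<Rightarrow> bool" where
  "wf_fm L Fls \<longleftrightarrow> True"
| "wf_fm L (Eq s t) \<longleftrightarrow> wf_trm L s \<and> wf_trm L t"
| "wf_fm L (Rel R ts) \<longleftrightarrow> rel_ar L R = Some (length ts) \<and> (\<forall>t\<in>set ts. wf_trm L t)"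
| "wf_fm L (Neg \<phi>) \<longleftrightarrow> wf_fm L \<phi>"
| "wf_fm L (Conj \<phi> \<psi>) \<longleftrightarrow> wf_fm L \<phi> \<and> wf_fm L \<psi>"
| "wf_fm L (Forall n \<phi>) \<longleftrightarrow> wf_fm L \<phi>"

fun quantifier_free :: "('f, 'r) fm \<Rightarrow> bool" where
  "quantifier_free (Neg \<phi>) \<longleftrightarrow> quantifier_free \<phi>"
| "quantifier_free (Conj \<phi> \<psi>) \<longleftrightarrow> quantifier_free \<phi> \<and> quantifier_free \<psi>"
| "quantifier_free (Forall n \<phi>) \<longleftrightarrow> False"
| "quantifier_free _ \<longleftrightarrow> True"

definition sentence :: "('f, 'r) lang \<Rightarrow> ('f, 'r) fm \<Rightarrow> bool" where
  "sentence L \<phi> \<longleftrightarrow> wf_fm L \<phi> \<and> fv \<phi> = {}"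

definition universal_theory :: "('f, 'r) lang \<Rightarrow> ('f, 'r) fm set \<Rightarrow> bool" where
  "universal_theory L T \<longleftrightarrow>
    (\<forall>\<phi>\<in>T. sentence L \<phi> \<and> (\<exists>ys \<psi>. quantifier_free \<psi> \<and> \<phi> = Foralls ys \<psi>))"

text \<open>The values of \<open>fun_of\<close> and \<open>rel_of\<close> matter only on tuples from the universe that have
  the arity prescribed by the language. Structures are nonempty.\<close>

record ('f, 'r, 'a) struct =
  univ :: "'a set"
  fun_of :: "'f \<Rightarrow> 'a list \<Rightarrow> 'a"
  rel_of :: "'r \<Rightarrow> 'a list \<Rightarrow> bool"

definition is_struct :: "('f, 'r) lang \<Rightarrow> ('f, 'r, 'a) struct \<Rightarrow> bool" where
  "is_struct L M \<longleftrightarrow> univ M \<noteq> {} \<and>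
    (\<forall>f as. fun_ar L f = Some (length as) \<longrightarrow> set as \<subseteq> univ M \<longrightarrow> fun_of M f as \<in> univ M)"

fun val :: "('f, 'r, 'a) struct \<Rightarrow> (nat \<Rightarrow> 'a) \<Rightarrow> 'f trm \<Rightarrow> 'a" where
  "val M e (Var n) = e n"
| "val M e (Fun f ts) = fun_of M f (map (val M e) ts)"

fun sat :: "('f, 'r, 'a) struct \<Rightarrow> (nat \<Rightarrow> 'a) \<Rightarrow> ('f, 'r) fm \<Rightarrow> bool" where
  "sat M e Fls \<longleftrightarrow> False"
| "sat M e (Eq s t) \<longleftrightarrow> val M e s = val M e t"
| "sat M e (Rel R ts) \<longleftrightarrow> rel_of M R (map (val M e) ts)"
| "sat M e (Neg \<phi>) \<longleftrightarrow> \<not> sat M e \<phi>"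
| "sat M e (Conj \<phi> \<psi>) \<longleftrightarrow> sat M e \<phi> \<and> sat M e \<psi>"
| "sat M e (Forall n \<phi>) \<longleftrightarrow> (\<forall>a\<in>univ M. sat M (e(n := a)) \<phi>)"

definition true_in :: "('f, 'r, 'a) struct \<Rightarrow> ('f, 'r) fm \<Rightarrow> bool" where
  "true_in M \<phi> \<longleftrightarrow> (\<forall>e. range e \<subseteq> univ M \<longrightarrow> sat M e \<phi>)"

definition models :: "('f, 'r) lang \<Rightarrow> ('f, 'r, 'a) struct \<Rightarrow> ('f, 'r) fm set \<Rightarrow> bool" where
  "models L M T \<longleftrightarrow> is_struct L M \<and> (\<forall>\<phi>\<in>T. true_in M \<phi>)"

definition theory_of :: "('f, 'r) lang \<Rightarrow> ('f, 'r, 'a) struct \<Rightarrow> ('f, 'r) fm set" where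
  "theory_of L M = {\<phi>. sentence L \<phi> \<and> true_in M \<phi>}"

definition embedding ::
  "('f, 'r) lang \<Rightarrow> ('f, 'r, 'a) struct \<Rightarrow> ('f, 'r, 'b) struct \<Rightarrow> ('a \<Rightarrow> 'b) \<Rightarrow> bool" where
  "embedding L M N h \<longleftrightarrow> inj_on h (univ M) \<and> h ` univ M \<subseteq> univ N \<and>
    (\<forall>f as. fun_ar L f = Some (length as) \<longrightarrow> set as \<subseteq> univ M \<longrightarrow>
       h (fun_of M f as) = fun_of N f (map h as)) \<and>
    (\<forall>R as. rel_ar L R = Some (length as) \<longrightarrow> set as \<subseteq> univ M \<longrightarrow>
       (rel_of M R as \<longleftrightarrow> rel_of N R (map h as)))"

definition isomorphism ::
  "('f, 'r) lang \<Rightarrow> ('f, 'r, 'a) struct \<Rightarrow> ('f, 'r, 'b) struct \<Rightarrow> ('a \<Rightarrow> 'b) \<Rightarrow> bool" where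
  "isomorphism L M N h \<longleftrightarrow> embedding L M N h \<and> h ` univ M = univ N"

definition substructure ::
  "('f, 'r) lang \<Rightarrow> ('f, 'r, 'a) struct \<Rightarrow> ('f, 'r, 'a) struct \<Rightarrow> bool" where
  "substructure L N M \<longleftrightarrow> is_struct L N \<and> is_struct L M \<and> embedding L N M id"

definition elementary_substructure ::
  "('f, 'r) lang \<Rightarrow> ('f, 'r, 'a) struct \<Rightarrow> ('f, 'r, 'a) struct \<Rightarrow> bool" where
  "elementary_substructure L N M \<longleftrightarrow> substructure L N M \<and>
    (\<forall>\<phi> e. wf_fm L \<phi> \<longrightarrow> range e \<subseteq> univ N \<longrightarrow> (sat N e \<phi> \<longleftrightarrow> sat M e \<phi>))"

definition finitely_generated :: "('f, 'r) lang \<Rightarrow> ('f, 'r, 'a) struct \<Rightarrow> bool" where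
  "finitely_generated L M \<longleftrightarrow> is_struct L M \<and>
    (\<exists>S. finite S \<and> S \<subseteq> univ M \<and>
      (\<forall>N. substructure L N M \<longrightarrow> S \<subseteq> univ N \<longrightarrow> univ N = univ M))"

section \<open>Fraisse classes and limits\<close>

text \<open>Classes of finitely generated structures in countable languages are represented by
  structures with universe contained in \<^typ>\<open>nat\<close>.\<close>

definition HP :: "('f, 'r) lang \<Rightarrow> ('f, 'r, nat) struct set \<Rightarrow> bool" where
  "HP L K \<longleftrightarrow>
    (\<forall>B\<in>K. \<forall>A. substructure L A B \<and> finitely_generated L A \<longrightarrow> A \<in> K)"

definition JEP :: "('f, 'r) lang \<Rightarrow> ('f, 'r, nat) struct set \<Rightarrow> bool" where
  "JEP L K \<longleftrightarrow>
    (\<forall>A\<in>K. \<forall>B\<in>K. \<exists>D\<in>K. \<exists>f g. embedding L A D f \<and> embedding L B D g)"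

definition AP :: "('f, 'r) lang \<Rightarrow> ('f, 'r, nat) struct set \<Rightarrow> bool" where
  "AP L K \<longleftrightarrow>
    (\<forall>A\<in>K. \<forall>B\<in>K. \<forall>C\<in>K. \<forall>f1 f2. embedding L A B f1 \<and> embedding L A C f2 \<longrightarrow>
      (\<exists>D\<in>K. \<exists>g1 g2. embedding L B D g1 \<and> embedding L C D g2 \<and>
        (\<forall>a\<in>univ A. g1 (f1 a) = g2 (f2 a))))"

definition fraisse_class :: "('f, 'r) lang \<Rightarrow> ('f, 'r, nat) struct set \<Rightarrow> bool" where
  "fraisse_class L K \<longleftrightarrow>
    (\<forall>A\<in>K. finitely_generated L A) \<and> HP L K \<and> JEP L K \<and> AP L K"

definition SAP :: "('f, 'r) lang \<Rightarrow> ('f, 'r, nat) struct set \<Rightarrow> bool" where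
  "SAP L K \<longleftrightarrow>
    (\<forall>A\<in>K. \<forall>B\<in>K. \<forall>C\<in>K. \<forall>f1 f2. embedding L A B f1 \<and> embedding L A C f2 \<longrightarrow>
      (\<exists>D\<in>K. \<exists>g1 g2. embedding L B D g1 \<and> embedding L C D g2 \<and>
        (\<forall>a\<in>univ A. g1 (f1 a) = g2 (f2 a)) \<and>
        g1 ` univ B \<inter> g2 ` univ C = (\<lambda>a. g2 (f2 a)) ` univ A)) \<and>
    (\<forall>A\<in>K. \<forall>B\<in>K. \<exists>D\<in>K. \<exists>f g. embedding L A D f \<and> embedding L B D g \<and>
      f ` univ A \<inter> g ` univ B = {})"

definition ultrahomogeneous :: "('f, 'r) lang \<Rightarrow> ('f, 'r, 'a) struct \<Rightarrow> bool" where
  "ultrahomogeneous L F \<longleftrightarrow>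
    (\<forall>A B h. substructure L A F \<and> finitely_generated L A \<and>
        substructure L B F \<and> finitely_generated L B \<and> isomorphism L A B h \<longrightarrow>
      (\<exists>g. isomorphism L F F g \<and> (\<forall>a\<in>univ A. g a = h a)))"

text \<open>The last two conditions state that the age of \<open>F\<close> is \<open>K\<close>, up to isomorphism.\<close>

definition fraisse_limit ::
  "('f, 'r) lang \<Rightarrow> ('f, 'r, nat) struct set \<Rightarrow> ('f, 'r, 'a) struct \<Rightarrow> bool" where
  "fraisse_limit L K F \<longleftrightarrow> is_struct L F \<and> (\<exists>f :: 'a \<Rightarrow> nat. inj_on f (univ F)) \<and>
    ultrahomogeneous L F \<and>
    (\<forall>A. substructure L A F \<and> finitely_generated L A \<longrightarrow> (\<exists>B\<in>K. \<exists>h. isomorphism L A B h)) \<and>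
    (\<forall>A\<in>K. \<exists>h. embedding L A F h)"

definition finite_models ::
  "('f, 'r) lang \<Rightarrow> ('f, 'r) fm set \<Rightarrow> ('f, 'r, nat) struct set" where
  "finite_models L T = {A. models L A T \<and> finite (univ A)}"

section \<open>Types, the monster model, forking\<close>

text \<open>A formula \<open>\<phi>(x, as)\<close> in the single variable \<open>x\<close> with parameters \<open>as\<close> is the pair
  \<open>(\<phi>, as)\<close>, where variable \<open>0\<close> stands for \<open>x\<close> and variable \<open>i + 1\<close> for the \<open>i\<close>-th parameter.\<close>

type_synonym ('f, 'r, 'a) pfm = "('f, 'r) fm \<times> 'a list"

definition formulas_over :: "('f, 'r) lang \<Rightarrow> 'a set \<Rightarrow> ('f, 'r, 'a) pfm set" where
  "formulas_over L A = {(\<phi>, as). wf_fm L \<phi> \<and> fv \<phi> \<subseteq> {..length as} \<and> set as \<subseteq> A}"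

definition psat :: "('f, 'r, 'a) struct \<Rightarrow> 'a \<Rightarrow> ('f, 'r, 'a) pfm \<Rightarrow> bool" where
  "psat C d \<psi> \<longleftrightarrow> sat C (\<lambda>i. (d # snd \<psi>) ! i) (fst \<psi>)"

definition realizes :: "('f, 'r, 'a) struct \<Rightarrow> 'a \<Rightarrow> ('f, 'r, 'a) pfm set \<Rightarrow> bool" where
  "realizes C d p \<longleftrightarrow> d \<in> univ C \<and> (\<forall>\<psi>\<in>p. psat C d \<psi>)"

definition finitely_satisfiable_in ::
  "('f, 'r, 'a) struct \<Rightarrow> 'a set \<Rightarrow> ('f, 'r, 'a) pfm set \<Rightarrow> bool" where
  "finitely_satisfiable_in C D p \<longleftrightarrow>
    (\<forall>p0. p0 \<subseteq> p \<longrightarrow> finite p0 \<longrightarrow> (\<exists>d\<in>D. realizes C d p0))"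

definition partial_type ::
  "('f, 'r) lang \<Rightarrow> ('f, 'r, 'a) struct \<Rightarrow> 'a set \<Rightarrow> ('f, 'r, 'a) pfm set \<Rightarrow> bool" where
  "partial_type L C A p \<longleftrightarrow> p \<subseteq> formulas_over L A \<and> finitely_satisfiable_in C (univ C) p"

definition complete_type ::
  "('f, 'r) lang \<Rightarrow> ('f, 'r, 'a) struct \<Rightarrow> 'a set \<Rightarrow> ('f, 'r, 'a) pfm set \<Rightarrow> bool" where
  "complete_type L C A p \<longleftrightarrow> partial_type L C A p \<and>
    (\<forall>(\<phi>, as)\<in>formulas_over L A. (\<phi>, as) \<in> p \<or> (Neg \<phi>, as) \<in> p)"

definition small :: "'k rel \<Rightarrow> 'a set \<Rightarrow> bool" where
  "small \<kappa> A \<longleftrightarrow> (card_of A, \<kappa>) \<in> ordLess"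

definition saturated :: "('f, 'r) lang \<Rightarrow> 'k rel \<Rightarrow> ('f, 'r, 'a) struct \<Rightarrow> bool" where
  "saturated L \<kappa> C \<longleftrightarrow>
    (\<forall>A p. A \<subseteq> univ C \<longrightarrow> small \<kappa> A \<longrightarrow> partial_type L C A p \<longrightarrow> (\<exists>d. realizes C d p))"

definition partial_elementary ::
  "('f, 'r) lang \<Rightarrow> ('f, 'r, 'a) struct \<Rightarrow> 'a set \<Rightarrow> ('a \<Rightarrow> 'a) \<Rightarrow> bool" where
  "partial_elementary L C A h \<longleftrightarrow> A \<subseteq> univ C \<and> h ` A \<subseteq> univ C \<and>
    (\<forall>\<phi> e. wf_fm L \<phi> \<longrightarrow> range e \<subseteq> A \<longrightarrow> (sat C e \<phi> \<longleftrightarrow> sat C (h \<circ> e) \<phi>))"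

definition strongly_homogeneous :: "('f, 'r) lang \<Rightarrow> 'k rel \<Rightarrow> ('f, 'r, 'a) struct \<Rightarrow> bool" where
  "strongly_homogeneous L \<kappa> C \<longleftrightarrow>
    (\<forall>A h. small \<kappa> A \<longrightarrow> partial_elementary L C A h \<longrightarrow>
      (\<exists>g. isomorphism L C C g \<and> (\<forall>a\<in>A. g a = h a)))"

text \<open>The cardinal \<open>\<kappa>\<close> exceeds the number of formulas of the language; in particular it is
  uncountable.\<close>

definition monster_model :: "('f, 'r) lang \<Rightarrow> 'k rel \<Rightarrow> ('f, 'r, 'a) struct \<Rightarrow> bool" where
  "monster_model L \<kappa> C \<longleftrightarrow> is_struct L C \<and> Card_order \<kappa> \<and> small \<kappa> {\<phi>. wf_fm L \<phi>} \<and>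
    saturated L \<kappa> C \<and> strongly_homogeneous L \<kappa> C"

definition same_type ::
  "('f, 'r) lang \<Rightarrow> ('f, 'r, 'a) struct \<Rightarrow> 'a set \<Rightarrow> 'a list \<Rightarrow> 'a list \<Rightarrow> bool" where
  "same_type L C A as bs \<longleftrightarrow> length as = length bs \<and>
    (\<forall>\<phi> cs. wf_fm L \<phi> \<longrightarrow> set cs \<subseteq> A \<longrightarrow> fv \<phi> \<subseteq> {..<length as + length cs} \<longrightarrow>
      (sat C (\<lambda>i. (as @ cs) ! i) \<phi> \<longleftrightarrow> sat C (\<lambda>i. (bs @ cs) ! i) \<phi>))"

definition divides ::
  "('f, 'r) lang \<Rightarrow> ('f, 'r, 'a) struct \<Rightarrow> 'a set \<Rightarrow> ('f, 'r, 'a) pfm \<Rightarrow> bool" where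
  "divides L C A \<psi> \<longleftrightarrow>
    (\<exists>(k :: nat) (b :: nat \<Rightarrow> 'a list).
      (\<forall>i. set (b i) \<subseteq> univ C \<and> same_type L C A (b i) (snd \<psi>)) \<and>
      (\<forall>I. finite I \<and> card I = k \<longrightarrow> \<not> (\<exists>d. realizes C d ((\<lambda>i. (fst \<psi>, b i)) ` I))))"

text \<open>Implication between (small) partial types and formulas is evaluated in the monster model.\<close>

definition forks ::
  "('f, 'r) lang \<Rightarrow> ('f, 'r, 'a) struct \<Rightarrow> 'a set \<Rightarrow> ('f, 'r, 'a) pfm set \<Rightarrow> bool" where
  "forks L C A p \<longleftrightarrow>
    (\<exists>\<Psi>. finite \<Psi> \<and> \<Psi> \<subseteq> formulas_over L (univ C) \<and> (\<forall>\<psi>\<in>\<Psi>. divides L C A \<psi>) \<and>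
      (\<forall>d. realizes C d p \<longrightarrow> (\<exists>\<psi>\<in>\<Psi>. psat C d \<psi>)))"

section \<open>Meet-trees and the starred theory\<close>

datatype tree_fun = Meet

datatype 'r star_sym = Leq | Star 'r

abbreviation meet :: "tree_fun trm \<Rightarrow> tree_fun trm \<Rightarrow> tree_fun trm" where
  "meet s t \<equiv> Fun Meet [s, t]"

abbreviation Le :: "tree_fun trm \<Rightarrow> tree_fun trm \<Rightarrow> (tree_fun, 'r star_sym) fm" where
  "Le s t \<equiv> Rel Leq [s, t]"

abbreviation Lt :: "tree_fun trm \<Rightarrow> tree_fun trm \<Rightarrow> (tree_fun, 'r star_sym) fm" where
  "Lt s t \<equiv> Conj (Le s t) (Neg (Eq s t))"

text \<open>Every relation symbol takes at least one argument: a nullary \<open>R\<close> would yield a unary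
  \<open>R\<^sup>*\<close> that neither (WD) nor (OC) constrains. As there are no function
  symbols, the type \<^typ>\<open>tree_fun\<close> serves for them; thus terms of \<open>L\<close> are terms of \<open>L\<^sup>*\<close>.\<close>

definition finite_relational :: "(tree_fun, 'r) lang \<Rightarrow> bool" where
  "finite_relational L \<longleftrightarrow>
    fun_ar L = Map.empty \<and> finite (dom (rel_ar L)) \<and> 0 \<notin> ran (rel_ar L)"

fun star_ar :: "(tree_fun, 'r) lang \<Rightarrow> 'r star_sym \<Rightarrow> nat option" where
  "star_ar L Leq = Some 2"
| "star_ar L (Star R) = map_option Suc (rel_ar L R)"

definition star_lang :: "(tree_fun, 'r) lang \<Rightarrow> (tree_fun, 'r star_sym) lang" where
  "star_lang L = \<lparr>fun_ar = (\<lambda>_. Some 2), rel_ar = star_ar L\<rparr>"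

definition Tr :: "(tree_fun, 'r star_sym) fm set" where
  "Tr = (let x = Var 0; y = Var 1; z = Var 2 in
   {Foralls [0] (Le x x),
    Foralls [0, 1] (Imp (Conj (Le x y) (Le y x)) (Eq x y)),
    Foralls [0, 1, 2] (Imp (Conj (Le x y) (Le y z)) (Le x z)),
    Foralls [0, 1, 2] (Imp (Conj (Le y x) (Le z x)) (Disj (Le y z) (Le z y))),
    Foralls [0, 1] (Conj (Le (meet x y) x) (Le (meet x y) y)),
    Foralls [0, 1, 2] (Imp (Conj (Le z x) (Le z y)) (Le z (meet x y)))})"

text \<open>In the next two axioms \<open>x\<close>, \<open>y\<^sub>i\<close> and \<open>y'\<^sub>i\<close> are the variables
  \<open>0\<close>, \<open>1 + i\<close> and \<open>1 + n + i\<close>.\<close>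

definition WD :: "'r \<Rightarrow> nat \<Rightarrow> (tree_fun, 'r star_sym) fm" where
  "WD R n = (let x = Var 0; y = (\<lambda>i. Var (1 + i)); y' = (\<lambda>i. Var (1 + n + i)) in
    Foralls [0..<1 + n + n]
      (Imp (Conj (Rel (Star R) (x # map y [0..<n]))
                 (Conjs (map (\<lambda>i. Lt x (meet (y i) (y' i))) [0..<n])))
           (Rel (Star R) (x # map y' [0..<n]))))"

definition OC :: "'r \<Rightarrow> nat \<Rightarrow> (tree_fun, 'r star_sym) fm" where
  "OC R n = (let x = Var 0; y = (\<lambda>i. Var (1 + i)) in
    Foralls [0..<1 + n]
      (Imp (Rel (Star R) (x # map y [0..<n])) (Conjs (map (\<lambda>i. Lt x (y i)) [0..<n]))))"

text \<open>\<open>star x \<psi>\<close> is \<open>\<psi>\<^sup>*(x, \<dots>)\<close>; it is used for quantifier-free \<open>\<psi>\<close> only.\<close>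

fun star :: "nat \<Rightarrow> (tree_fun, 'r) fm \<Rightarrow> (tree_fun, 'r star_sym) fm" where
  "star x Fls = Fls"
| "star x (Eq s t) = Lt (Var x) (meet s t)"
| "star x (Rel R ts) = Rel (Star R) (Var x # ts)"
| "star x (Neg \<phi>) = Neg (star x \<phi>)"
| "star x (Conj \<phi> \<psi>) = Conj (star x \<phi>) (star x \<psi>)"
| "star x (Forall n \<phi>) = Forall n (star x \<phi>)"

definition star_theory ::
  "(tree_fun, 'r) lang \<Rightarrow> (tree_fun, 'r) fm set \<Rightarrow> (tree_fun, 'r star_sym) fm set" where
  "star_theory L T = Tr \<union>
    {WD R n | R n. rel_ar L R = Some n} \<union>
    {OC R n | R n. rel_ar L R = Some n} \<union>
    {Foralls (x # ys) (Imp (Conjs (map (\<lambda>y. Lt (Var x) (Var y)) ys)) (star x \<psi>)) | x ys \<psi>.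
      Foralls ys \<psi> \<in> T \<and> quantifier_free \<psi> \<and> x \<notin> set ys}"

definition branch :: "(tree_fun, 'r star_sym, 'a) struct \<Rightarrow> 'a set \<Rightarrow> bool" where
  "branch M B \<longleftrightarrow> pred_on.maxchain (univ M) (\<lambda>a b. rel_of M Leq [a, b]) B"

definition above :: "'a \<Rightarrow> (tree_fun, 'r star_sym, 'a) pfm" where
  "above b = (Lt (Var 1) (Var 0), [b])"

definition below :: "'a \<Rightarrow> (tree_fun, 'r star_sym, 'a) pfm" where
  "below c = (Lt (Var 0) (Var 1), [c])"

end

theory Submission
  imports Defs
begin

text \<open>
  Let finitely many parameters from \<open>M\<close> be given. Some point \<open>b\<close> of the branch \<open>B\<close> lies below none
  of them (\<open>branch_cofinal\<close>): \<open>M\<close> has no maximal elements, because \<open>C\<close> contains a pair \<open>b < c\<close> and all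
  one-point substructures are isomorphic. From the parameters and their meets, \<open>b\<close> and the point \<open>c\<close> above it
  cannot be distinguished: they have the same meets with the parameters, and the relations
  \<open>R\<^sup>*(x, \<dots>)\<close> depend only on the open cones above \<open>x\<close>, which contain \<open>b\<close> and \<open>c\<close> together. Therefore
  replacing \<open>b\<close> by \<open>c\<close> is an isomorphism between the finite substructures that the parameters
  generate with \<open>b\<close> and with \<open>c\<close> (\<open>embedding_move_top\<close>).

  Isomorphisms between finite substructures of \<open>C\<close> preserve all formulas (\<open>sat_atomic_equiv\<close>). In the
  Fraisse limit this is ultrahomogeneity, and it passes to elementarily equivalent
  structures because the extension steps of the back-and-forth argument are expressed by diagrams,
  which are single formulas in a finite language, while finite sets of points generate finite
  subtrees (\<open>extend_atomic_equiv\<close>). So \<open>b\<close> and \<open>c\<close> have the same type over the given parameters. It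
  follows that each finite part of \<open>q\<close> is realized by a point of \<open>B\<close>, and the points of \<open>B\<close> are
  below \<open>c\<close>.

  Finally, a partial type that is finitely satisfiable in \<open>M\<close> does not fork over \<open>M\<close>
  (\<open>not_forks_if_finitely_satisfiable\<close>): an element of \<open>M\<close> never satisfies a formula that divides
  over \<open>M\<close>.
\<close>

section \<open>Formulas, embeddings and universal sentences\<close>

lemma finite_fv_trm: "finite (fv_trm t)"
  by (induction t) auto

lemma finite_fv: "finite (fv \<phi>)"
  by (induction \<phi>) (auto simp: finite_fv_trm)

lemma val_cong: "(\<And>v. v \<in> fv_trm t \<Longrightarrow> e v = e' v) \<Longrightarrow> val M e t = val M e' t"
proof (induction t)
  case (Fun f ts)
  then have "map (val M e) ts = map (val M e') ts" by (auto intro!: map_cong)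
  then show ?case by (metis val.simps(2))
qed simp

lemma sat_cong: "(\<And>v. v \<in> fv \<phi> \<Longrightarrow> e v = e' v) \<Longrightarrow> sat M e \<phi> \<longleftrightarrow> sat M e' \<phi>"
proof (induction \<phi> arbitrary: e e')
  case (Eq s t)
  then have "val M e s = val M e' s" "val M e t = val M e' t" by (auto intro!: val_cong)
  then show ?case by simp
next
  case (Rel R ts)
  then have "map (val M e) ts = map (val M e') ts" by (auto intro!: map_cong val_cong)
  then show ?case by (metis sat.simps(3))
next
  case (Neg \<phi>)
  then show ?case by (metis fv.simps(4) sat.simps(4))
next
  case (Conj \<phi> \<psi>)
  then show ?case by (metis UnCI fv.simps(5) sat.simps(5))
next
  case (Forall n \<phi>)
  have "sat M (e(n := a)) \<phi> \<longleftrightarrow> sat M (e'(n := a)) \<phi>" for a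
    by (rule Forall.IH) (use Forall.prems in auto)
  then show ?case by simp
qed simp

lemma sat_Foralls:
  "sat M e (Foralls xs \<phi>) \<longleftrightarrow>
    (\<forall>e'. (\<forall>v. v \<notin> set xs \<longrightarrow> e' v = e v) \<longrightarrow> e' ` set xs \<subseteq> univ M \<longrightarrow> sat M e' \<phi>)"
proof (induction xs arbitrary: e)
  case Nil
  show ?case by (simp add: Foralls_def flip: fun_eq_iff)
next
  case (Cons x xs)
  have "sat M e (Foralls (x # xs) \<phi>) \<longleftrightarrow> (\<forall>a\<in>univ M. sat M (e(x := a)) (Foralls xs \<phi>))"
    by (simp add: Foralls_def)
  also have "\<dots> \<longleftrightarrow> (\<forall>e'. (\<forall>v. v \<notin> set (x # xs) \<longrightarrow> e' v = e v) \<longrightarrow>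
      e' ` set (x # xs) \<subseteq> univ M \<longrightarrow> sat M e' \<phi>)" (is "?l \<longleftrightarrow> ?r")
  proof
    assume l: ?l
    show ?r
    proof (intro allI impI)
      fix e' assume e': "\<forall>v. v \<notin> set (x # xs) \<longrightarrow> e' v = e v" "e' ` set (x # xs) \<subseteq> univ M"
      then have "sat M (e(x := e' x)) (Foralls xs \<phi>)" using l by auto
      then show "sat M e' \<phi>" unfolding Cons.IH using e' by auto
    qed
  next
    assume r: ?r
    show ?l unfolding Cons.IH
    proof (intro ballI allI impI)
      fix a e' assume a: "a \<in> univ M" "\<forall>v. v \<notin> set xs \<longrightarrow> e' v = (e(x := a)) v"
        "e' ` set xs \<subseteq> univ M"
      then have "e' x \<in> univ M" by (metis fun_upd_same image_subset_iff)
      then show "sat M e' \<phi>" using a r by auto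
    qed
  qed
  finally show ?case .
qed

text \<open>Truth quantifies over all assignments, so a quantifier prefix can be dropped: the axioms of
  a universal theory may be handled as quantifier-free formulas.\<close>

lemma true_in_Foralls: "true_in M (Foralls xs \<phi>) \<longleftrightarrow> true_in M \<phi>"
  unfolding true_in_def sat_Foralls
proof (intro iffI allI impI)
  fix e e' :: "nat \<Rightarrow> 'c"
  assume "\<forall>e. range e \<subseteq> univ M \<longrightarrow> sat M e \<phi>" "range e \<subseteq> univ M"
    "\<forall>v. v \<notin> set xs \<longrightarrow> e' v = e v" "e' ` set xs \<subseteq> univ M"
  moreover from this have "e' v \<in> univ M" for v by (cases "v \<in> set xs") auto
  then have "range e' \<subseteq> univ M" by auto
  ultimately show "sat M e' \<phi>" by blast
next
  fix e :: "nat \<Rightarrow> 'c"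
  assume "\<forall>e. range e \<subseteq> univ M \<longrightarrow> (\<forall>e'. (\<forall>v. v \<notin> set xs \<longrightarrow> e' v = e v) \<longrightarrow>
    e' ` set xs \<subseteq> univ M \<longrightarrow> sat M e' \<phi>)" "range e \<subseteq> univ M"
  then show "sat M e \<phi>" by (simp add: image_subset_iff)
qed

lemma fv_Foralls: "fv (Foralls xs \<phi>) = fv \<phi> - set xs"
  by (induction xs) (auto simp: Foralls_def)

lemma wf_fm_Foralls: "wf_fm L (Foralls xs \<phi>) \<longleftrightarrow> wf_fm L \<phi>"
  by (induction xs) (auto simp: Foralls_def)

lemma sat_Conjs: "sat M e (Conjs \<phi>s) \<longleftrightarrow> (\<forall>\<phi>\<in>set \<phi>s. sat M e \<phi>)"
  by (induction \<phi>s) (auto simp: Conjs_def)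

lemma fv_Conjs: "fv (Conjs \<phi>s) = (\<Union>\<phi>\<in>set \<phi>s. fv \<phi>)"
  by (induction \<phi>s) (auto simp: Conjs_def)

lemma wf_fm_Conjs: "wf_fm L (Conjs \<phi>s) \<longleftrightarrow> (\<forall>\<phi>\<in>set \<phi>s. wf_fm L \<phi>)"
  by (induction \<phi>s) (auto simp: Conjs_def)

lemma quantifier_free_Conjs:
  "quantifier_free (Conjs \<phi>s) \<longleftrightarrow> (\<forall>\<phi>\<in>set \<phi>s. quantifier_free \<phi>)"
  by (induction \<phi>s) (auto simp: Conjs_def)

lemma val_embedding:
  assumes "is_struct L M" "embedding L M N h" "wf_trm L t" "\<And>v. v \<in> fv_trm t \<Longrightarrow> e v \<in> univ M"
  shows "val M e t \<in> univ M \<and> val N (h \<circ> e) t = h (val M e t)"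
  using assms(3,4)
proof (induction t)
  case (Fun f ts)
  then have IH: "val M e t \<in> univ M" "val N (h \<circ> e) t = h (val M e t)" if "t \<in> set ts" for t
    using that by fastforce+
  have "map (val N (h \<circ> e)) ts = map h (map (val M e) ts)" using IH(2) by simp
  moreover have "set (map (val M e) ts) \<subseteq> univ M" using IH(1) by auto
  moreover have "fun_ar L f = Some (length (map (val M e) ts))" using Fun.prems(1) by simp
  ultimately show ?case using assms(1,2) unfolding is_struct_def embedding_def
    by (metis val.simps(2))
qed simp

text \<open>One induction serves for embeddings, which preserve quantifier-free formulas, and for
  isomorphisms, which preserve all formulas: surjectivity is used at quantifiers only.\<close>

lemma sat_embedding:
  assumes "is_struct L M" "embedding L M N h"
    and "quantifier_free \<phi> \<or> h ` univ M = univ N"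
    and "wf_fm L \<phi>" "\<And>v. v \<in> fv \<phi> \<Longrightarrow> e v \<in> univ M"
  shows "sat M e \<phi> \<longleftrightarrow> sat N (h \<circ> e) \<phi>"
  using assms(3-5)
proof (induction \<phi> arbitrary: e)
  case (Eq s t)
  have s: "val M e s \<in> univ M \<and> val N (h \<circ> e) s = h (val M e s)"
    by (rule val_embedding[OF assms(1,2)]) (use Eq.prems in auto)
  have t: "val M e t \<in> univ M \<and> val N (h \<circ> e) t = h (val M e t)"
    by (rule val_embedding[OF assms(1,2)]) (use Eq.prems in auto)
  have "inj_on h (univ M)" using assms(2) by (simp add: embedding_def)
  then show ?case unfolding sat.simps using s t by (metis inj_on_eq_iff)
next
  case (Rel R ts)
  have ts: "val M e t \<in> univ M \<and> val N (h \<circ> e) t = h (val M e t)" if "t \<in> set ts" for t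
    by (rule val_embedding[OF assms(1,2)]) (use Rel.prems that in auto)
  then have "map (val N (h \<circ> e)) ts = map h (map (val M e) ts)" by simp
  moreover have "set (map (val M e) ts) \<subseteq> univ M" using ts by auto
  moreover have "rel_ar L R = Some (length (map (val M e) ts))" using Rel.prems(2) by simp
  ultimately show ?case using assms(2) unfolding embedding_def by (metis sat.simps(3))
next
  case (Forall n \<phi>)
  then have h: "h ` univ M = univ N" by simp
  have "sat M (e(n := a)) \<phi> \<longleftrightarrow> sat N ((h \<circ> e)(n := h a)) \<phi>" if "a \<in> univ M" for a
  proof -
    have "sat M (e(n := a)) \<phi> \<longleftrightarrow> sat N (h \<circ> e(n := a)) \<phi>"
      by (rule Forall.IH) (use Forall.prems h that in auto)
    moreover have "h \<circ> e(n := a) = (h \<circ> e)(n := h a)" by auto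
    ultimately show ?thesis by simp
  qed
  then show ?case unfolding sat.simps h[symmetric] by blast
qed auto

definition closed_under :: "('f, 'r) lang \<Rightarrow> ('f, 'r, 'a) struct \<Rightarrow> 'a set \<Rightarrow> bool" where
  "closed_under L M X \<longleftrightarrow>
    (\<forall>f as. fun_ar L f = Some (length as) \<longrightarrow> set as \<subseteq> X \<longrightarrow> fun_of M f as \<in> X)"

lemma substructure_restrict:
  assumes "is_struct L M" "X \<subseteq> univ M" "X \<noteq> {}" "closed_under L M X"
  shows "substructure L (M\<lparr>univ := X\<rparr>) M"
  using assms by (simp add: substructure_def is_struct_def embedding_def closed_under_def)

lemma closed_under_substructure:
  assumes "substructure L N (M\<lparr>univ := Y\<rparr>)"
  shows "closed_under L M (univ N)"
  using assms by (clarsimp simp: substructure_def is_struct_def embedding_def closed_under_def)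

lemma finitely_generated_finite:
  assumes "is_struct L A" "finite (univ A)" shows "finitely_generated L A"
  unfolding finitely_generated_def
  using assms by (intro conjI exI[of _ "univ A"]) (auto simp: substructure_def embedding_def)

text \<open>The intersection of all closed sets that contain \<open>S\<close> is the universe of such a substructure.
  The set \<open>S\<close> is nonempty because structures are.\<close>

lemma finitely_generated_hull:
  assumes "is_struct L M" "finite S" "S \<subseteq> univ M" "S \<noteq> {}"
  obtains A where "substructure L A M" "finitely_generated L A" "S \<subseteq> univ A"
proof
  define X where "X = \<Inter>{Y. S \<subseteq> Y \<and> Y \<subseteq> univ M \<and> closed_under L M Y}"
  have "closed_under L M (univ M)" using assms(1) by (simp add: is_struct_def closed_under_def)
  then have X: "S \<subseteq> X" "X \<subseteq> univ M" using assms(3) by (auto simp: X_def)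
  have cl: "closed_under L M X" unfolding closed_under_def
  proof (intro allI impI)
    fix f as assume fas: "fun_ar L f = Some (length as)" "set as \<subseteq> X"
    show "fun_of M f as \<in> X" unfolding X_def
    proof
      fix Y assume Y: "Y \<in> {Y. S \<subseteq> Y \<and> Y \<subseteq> univ M \<and> closed_under L M Y}"
      then have "set as \<subseteq> Y" using fas(2) unfolding X_def by blast
      with Y fas(1) show "fun_of M f as \<in> Y" by (simp add: closed_under_def)
    qed
  qed
  let ?A = "M\<lparr>univ := X\<rparr>"
  show sub: "substructure L ?A M"
    by (rule substructure_restrict) (use assms X cl in auto)
  show "S \<subseteq> univ ?A" using X by simp
  show "finitely_generated L ?A" unfolding finitely_generated_def
  proof (intro conjI exI[of _ S] allI impI)
    show "is_struct L ?A" using sub by (simp add: substructure_def)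
    fix N assume N: "substructure L N ?A" "S \<subseteq> univ N"
    have NX: "univ N \<subseteq> X" using N(1) by (auto simp: substructure_def embedding_def)
    moreover have "X \<subseteq> univ N"
      unfolding X_def using N X NX closed_under_substructure[OF N(1)] by blast
    ultimately show "univ N = univ ?A" by simp
  qed (use assms X in auto)
qed

text \<open>A quantifier-free formula speaks of finitely many elements, which generate a substructure;
  up to isomorphism this substructure belongs to \<open>K\<close>.\<close>

lemma true_in_fraisse_limit:
  assumes F: "fraisse_limit L K F"
    and K: "\<And>A. A \<in> K \<Longrightarrow> true_in A \<psi>"
    and \<psi>: "quantifier_free \<psi>" "wf_fm L \<psi>"
  shows "true_in F \<psi>"
  unfolding true_in_def
proof (intro allI impI)
  fix e :: "nat \<Rightarrow> 'c" assume e: "range e \<subseteq> univ F"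
  have F_struct: "is_struct L F" using F by (simp add: fraisse_limit_def)
  obtain A where A: "substructure L A F" "finitely_generated L A" "insert (e 0) (e ` fv \<psi>) \<subseteq> univ A"
    by (rule finitely_generated_hull[OF F_struct, of "insert (e 0) (e ` fv \<psi>)"])
      (use e finite_fv[of \<psi>] in auto)
  obtain B h where B: "B \<in> K" "isomorphism L A B h"
    using F A(1,2) unfolding fraisse_limit_def by blast
  \<comment> \<open>The hull need not contain the values of \<open>e\<close> at the other variables.\<close>
  define e' where "e' = (\<lambda>v. if v \<in> fv \<psi> then e v else e 0)"
  have e': "range e' \<subseteq> univ A" using A(3) by (auto simp: e'_def)
  have A_struct: "is_struct L A" using A(1) by (simp add: substructure_def)
  have "range (h \<circ> e') \<subseteq> univ B"
    using B(2) e' by (auto simp: isomorphism_def image_subset_iff)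
  then have "sat B (h \<circ> e') \<psi>" using K[OF B(1)] unfolding true_in_def by blast
  then have "sat A e' \<psi>"
    using sat_embedding[OF A_struct, of B h \<psi> e'] B(2) \<psi> e' unfolding isomorphism_def by blast
  moreover have "embedding L A F id" using A(1) by (simp add: substructure_def)
  ultimately have "sat F (id \<circ> e') \<psi>"
    using sat_embedding[OF A_struct, of F id \<psi> e'] \<psi> e' by blast
  then show "sat F e \<psi>" using sat_cong[of \<psi> e "id \<circ> e'"] by (simp add: e'_def)
qed

lemma sentence_true_in_iff:
  assumes "sentence L \<sigma>" "range e \<subseteq> univ M"
  shows "true_in M \<sigma> \<longleftrightarrow> sat M e \<sigma>"
proof -
  have "sat M e' \<sigma> \<longleftrightarrow> sat M e \<sigma>" for e'
    by (rule sat_cong) (use assms(1) in \<open>simp add: sentence_def\<close>)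
  then show ?thesis using assms(2) by (auto simp: true_in_def)
qed

lemma obtain_env:
  fixes M :: "('f, 'r, 'a) struct"
  assumes "is_struct L M" obtains e :: "nat \<Rightarrow> 'a" where "range e \<subseteq> univ M"
proof -
  obtain a where "a \<in> univ M" using assms by (auto simp: is_struct_def)
  then show thesis by (intro that[of "\<lambda>_. a"]) auto
qed

definition elem_equiv ::
  "('f, 'r) lang \<Rightarrow> ('f, 'r, 'a) struct \<Rightarrow> ('f, 'r, 'b) struct \<Rightarrow> bool" where
  "elem_equiv L M N \<longleftrightarrow> (\<forall>\<sigma>. sentence L \<sigma> \<longrightarrow> (true_in M \<sigma> \<longleftrightarrow> true_in N \<sigma>))"

lemma elem_equivD: "elem_equiv L M N \<Longrightarrow> sentence L \<sigma> \<Longrightarrow> true_in M \<sigma> \<longleftrightarrow> true_in N \<sigma>"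
  by (simp add: elem_equiv_def)

text \<open>A theory of the form \<open>theory_of L F\<close> is complete: it contains each sentence or its negation.\<close>

lemma elem_equiv_theory_of:
  fixes F :: "('f, 'r, 'c) struct" and M C :: "('f, 'r, 'd) struct"
  assumes "is_struct L F" "models L M (theory_of L F)" "elementary_substructure L M C"
  shows "elem_equiv L F C"
  unfolding elem_equiv_def
proof (intro allI impI)
  fix \<sigma> assume \<sigma>: "sentence L \<sigma>"
  have M: "is_struct L M" using assms(2) by (simp add: models_def)
  have th: "true_in M \<tau>" if "sentence L \<tau>" "true_in F \<tau>" for \<tau>
    using that assms(2) by (auto simp: models_def theory_of_def)
  have neg: "sentence L (Neg \<sigma>)" using \<sigma> by (simp add: sentence_def)
  obtain e :: "nat \<Rightarrow> 'c" where e: "range e \<subseteq> univ F" by (rule obtain_env[OF assms(1)])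
  obtain e' :: "nat \<Rightarrow> 'd" where e': "range e' \<subseteq> univ M" by (rule obtain_env[OF M])
  have C: "range e' \<subseteq> univ C"
    using e' assms(3) by (auto simp: elementary_substructure_def substructure_def embedding_def)
  have "true_in F \<sigma> \<longleftrightarrow> true_in M \<sigma>"
    using th[OF \<sigma>] th[OF neg] sentence_true_in_iff[OF \<sigma> e] sentence_true_in_iff[OF \<sigma> e']
      sentence_true_in_iff[OF neg e] sentence_true_in_iff[OF neg e'] by auto
  also have "\<dots> \<longleftrightarrow> true_in C \<sigma>"
    using sentence_true_in_iff[OF \<sigma> e'] sentence_true_in_iff[OF \<sigma> C] assms(3) e' \<sigma>
    by (auto simp: elementary_substructure_def sentence_def)
  finally show "true_in F \<sigma> \<longleftrightarrow> true_in C \<sigma>" .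
qed

section \<open>Finite partial isomorphisms preserve formulas\<close>

text \<open>Without nested terms: on a tuple that enumerates a closed set these formulas already describe
  the whole substructure, and in a finite language there are only finitely many of them.\<close>

definition atoms :: "('f, 'r) lang \<Rightarrow> nat \<Rightarrow> ('f, 'r) fm set" where
  "atoms L n =
    {Eq (Var i) (Var j) | i j. i < n \<and> j < n} \<union>
    {Eq (Fun f (map Var is)) (Var j) | f is j.
      fun_ar L f = Some (length is) \<and> set is \<subseteq> {..<n} \<and> j < n} \<union>
    {Rel R (map Var is) | R is. rel_ar L R = Some (length is) \<and> set is \<subseteq> {..<n}}"

lemma finite_atoms:
  assumes "finite (dom (fun_ar L))" "finite (dom (rel_ar L))"
  shows "finite (atoms L n)"
proof -
  let ?l = "\<lambda>k. {is. set is \<subseteq> {..<n} \<and> length is = k}"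
  have "atoms L n \<subseteq> (\<lambda>(i, j). Eq (Var i) (Var j)) ` ({..<n} \<times> {..<n}) \<union>
    (\<Union>f\<in>dom (fun_ar L). (\<lambda>(is, j). Eq (Fun f (map Var is)) (Var j)) `
      (?l (the (fun_ar L f)) \<times> {..<n})) \<union>
    (\<Union>R\<in>dom (rel_ar L). (\<lambda>is. Rel R (map Var is)) ` ?l (the (rel_ar L R)))"
    unfolding atoms_def by (fastforce simp: dom_def)
  moreover have "finite \<dots>" using assms by (intro finite_UnI finite_UN_I finite_imageI
      finite_cartesian_product finite_lists_length_eq) auto
  ultimately show ?thesis by (rule finite_subset)
qed

lemma atoms_mono: "n \<le> m \<Longrightarrow> atoms L n \<subseteq> atoms L m"
  unfolding atoms_def by (fastforce simp: subset_iff)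

lemma fv_atoms: "\<phi> \<in> atoms L n \<Longrightarrow> fv \<phi> \<subseteq> {..<n}"
  unfolding atoms_def by auto

lemma wf_fm_atoms: "\<phi> \<in> atoms L n \<Longrightarrow> wf_fm L \<phi>"
  unfolding atoms_def by auto

lemma quantifier_free_atoms: "\<phi> \<in> atoms L n \<Longrightarrow> quantifier_free \<phi>"
  unfolding atoms_def by auto

text \<open>For tuples that enumerate closed sets this says that \<open>e i \<mapsto> e' i\<close> is an isomorphism of the
  enumerated substructures. Tuples are initial segments of assignments, so that they can be used
  directly to evaluate formulas.\<close>

definition atomic_equiv ::
  "('f, 'r) lang \<Rightarrow> nat \<Rightarrow> ('f, 'r, 'a) struct \<Rightarrow> (nat \<Rightarrow> 'a) \<Rightarrow>
    ('f, 'r, 'b) struct \<Rightarrow> (nat \<Rightarrow> 'b) \<Rightarrow> bool" where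
  "atomic_equiv L n M e N e' \<longleftrightarrow> (\<forall>\<phi>\<in>atoms L n. sat M e \<phi> \<longleftrightarrow> sat N e' \<phi>)"

lemma atomic_equiv_sym: "atomic_equiv L n M e N e' \<Longrightarrow> atomic_equiv L n N e' M e"
  by (auto simp: atomic_equiv_def)

lemma atomic_equiv_trans:
  "atomic_equiv L n M e N e' \<Longrightarrow> atomic_equiv L n N e' P e'' \<Longrightarrow> atomic_equiv L n M e P e''"
  by (auto simp: atomic_equiv_def)

lemma atomic_equiv_mono: "atomic_equiv L m M e N e' \<Longrightarrow> n \<le> m \<Longrightarrow> atomic_equiv L n M e N e'"
  using atoms_mono[of n m L] by (auto simp: atomic_equiv_def)

lemma atomic_equiv_cong:
  assumes "atomic_equiv L n M e N e'" "\<And>i. i < n \<Longrightarrow> e i = f i" "\<And>i. i < n \<Longrightarrow> e' i = f' i"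
  shows "atomic_equiv L n M f N f'"
  unfolding atomic_equiv_def
proof
  fix \<phi> assume \<phi>: "\<phi> \<in> atoms L n"
  have "sat M e \<phi> \<longleftrightarrow> sat M f \<phi>" "sat N e' \<phi> \<longleftrightarrow> sat N f' \<phi>"
    using fv_atoms[OF \<phi>] assms(2,3) by (auto intro!: sat_cong)
  then show "sat M f \<phi> \<longleftrightarrow> sat N f' \<phi>" using assms(1) \<phi> by (simp add: atomic_equiv_def)
qed

lemma atomic_equiv_Eq:
  assumes "atomic_equiv L n M e N e'" "i < n" "j < n"
  shows "e i = e j \<longleftrightarrow> e' i = e' j"
proof -
  have "Eq (Var i) (Var j) \<in> atoms L n" using assms by (simp add: atoms_def)
  then have "sat M e (Eq (Var i) (Var j)) \<longleftrightarrow> sat N e' (Eq (Var i) (Var j))"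
    using assms(1) unfolding atomic_equiv_def by blast
  then show ?thesis by simp
qed

lemma atomic_equiv_Fun:
  assumes "atomic_equiv L n M e N e'"
    and "fun_ar L f = Some (length is)" "set is \<subseteq> {..<n}" "j < n"
  shows "fun_of M f (map e is) = e j \<longleftrightarrow> fun_of N f (map e' is) = e' j"
proof -
  have "Eq (Fun f (map Var is)) (Var j) \<in> atoms L n" using assms(2-) by (auto simp: atoms_def)
  then have "sat M e (Eq (Fun f (map Var is)) (Var j)) \<longleftrightarrow>
      sat N e' (Eq (Fun f (map Var is)) (Var j))"
    using assms(1) unfolding atomic_equiv_def by blast
  then show ?thesis by (simp add: comp_def)
qed

lemma atomic_equiv_Rel:
  assumes "atomic_equiv L n M e N e'"
    and "rel_ar L R = Some (length is)" "set is \<subseteq> {..<n}"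
  shows "rel_of M R (map e is) \<longleftrightarrow> rel_of N R (map e' is)"
proof -
  have "Rel R (map Var is) \<in> atoms L n" using assms(2-) by (auto simp: atoms_def)
  then have "sat M e (Rel R (map Var is)) \<longleftrightarrow> sat N e' (Rel R (map Var is))"
    using assms(1) unfolding atomic_equiv_def by blast
  then show ?thesis by (simp add: comp_def)
qed

lemma list_in_image:
  assumes "set as \<subseteq> e ` A" obtains "is" where "set is \<subseteq> A" "as = map e is"
proof -
  have "as \<in> lists (e ` A)" using assms by auto
  then show thesis using that by (auto simp: lists_image)
qed

text \<open>Closedness is visible in the atomic formulas: an equation \<open>f(x\<^sub>i, \<dots>) = x\<^sub>j\<close> that holds for
  \<open>e\<close> also holds for \<open>e'\<close>.\<close>

lemma closed_under_atomic_equiv: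
  assumes eq: "atomic_equiv L n M e N e'" and cl: "closed_under L M (e ` {..<n})"
  shows "closed_under L N (e' ` {..<n})"
  unfolding closed_under_def
proof (intro allI impI)
  fix f as assume f: "fun_ar L f = Some (length as)" "set as \<subseteq> e' ` {..<n}"
  from f(2) obtain "is" where "is": "set is \<subseteq> {..<n}" "as = map e' is" by (rule list_in_image)
  have "set (map e is) \<subseteq> e ` {..<n}" using "is"(1) by auto
  moreover have "fun_ar L f = Some (length (map e is))" using f "is"(2) by simp
  ultimately have "fun_of M f (map e is) \<in> e ` {..<n}" using cl unfolding closed_under_def by blast
  then obtain j where j: "j < n" "fun_of M f (map e is) = e j" by auto
  then have "fun_of N f as = e' j"
    using atomic_equiv_Fun[OF eq, of f "is" j] f "is" by simp
  then show "fun_of N f as \<in> e' ` {..<n}" using j by simp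
qed

lemma isomorphism_of_atomic_equiv:
  assumes eq: "atomic_equiv L n M e N e'" and cl: "closed_under L M (e ` {..<n})"
  obtains h where "\<And>i. i < n \<Longrightarrow> h (e i) = e' i"
    "isomorphism L (M\<lparr>univ := e ` {..<n}\<rparr>) (N\<lparr>univ := e' ` {..<n}\<rparr>) h"
proof -
  define h where "h = (\<lambda>x. e' (SOME i. i < n \<and> e i = x))"
  have h: "h (e i) = e' i" if "i < n" for i
  proof -
    have "(SOME j. j < n \<and> e j = e i) < n \<and> e (SOME j. j < n \<and> e j = e i) = e i"
      by (rule someI[of _ i]) (use that in simp)
    then show ?thesis using atomic_equiv_Eq[OF eq, of "SOME j. j < n \<and> e j = e i" i] that
      by (simp add: h_def)
  qed
  have map_h: "map h (map e is) = map e' is" if "set is \<subseteq> {..<n}" for "is"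
    using that h by auto
  have inj: "inj_on h (e ` {..<n})" using atomic_equiv_Eq[OF eq] h by (auto intro!: inj_onI)
  have im: "h ` e ` {..<n} = e' ` {..<n}" using h by (auto simp: image_iff)
  have funs: "h (fun_of M f as) = fun_of N f (map h as)"
    if f: "fun_ar L f = Some (length as)" "set as \<subseteq> e ` {..<n}" for f as
  proof -
    have "fun_of M f as \<in> e ` {..<n}" using cl f by (simp add: closed_under_def)
    then obtain j where j: "j < n" "fun_of M f as = e j" by auto
    from f(2) obtain "is" where "is": "set is \<subseteq> {..<n}" "as = map e is" by (rule list_in_image)
    have "fun_of N f (map e' is) = e' j"
      using atomic_equiv_Fun[OF eq, of f "is" j] f j "is" by simp
    then show ?thesis using j h unfolding "is"(2) map_h[OF "is"(1)] by simp
  qed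
  have rels: "rel_of M R as \<longleftrightarrow> rel_of N R (map h as)"
    if R: "rel_ar L R = Some (length as)" "set as \<subseteq> e ` {..<n}" for R as
  proof -
    from R(2) obtain "is" where "is": "set is \<subseteq> {..<n}" "as = map e is" by (rule list_in_image)
    then show ?thesis
      using atomic_equiv_Rel[OF eq, of R "is"] R(1) unfolding "is"(2) map_h[OF "is"(1)] by simp
  qed
  have "isomorphism L (M\<lparr>univ := e ` {..<n}\<rparr>) (N\<lparr>univ := e' ` {..<n}\<rparr>) h"
    using inj im funs rels by (simp add: isomorphism_def embedding_def)
  then show thesis using that h by blast
qed

lemma ultrahomogeneous_atomic_equiv:
  assumes F: "is_struct L F" "ultrahomogeneous L F"
    and e: "range e \<subseteq> univ F" "range e' \<subseteq> univ F" "n > 0" "closed_under L F (e ` {..<n})"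
    and eq: "atomic_equiv L n F e F e'"
  obtains g where "isomorphism L F F g" "\<And>i. i < n \<Longrightarrow> g (e i) = e' i"
proof -
  obtain h where h: "\<And>i. i < n \<Longrightarrow> h (e i) = e' i"
    "isomorphism L (F\<lparr>univ := e ` {..<n}\<rparr>) (F\<lparr>univ := e' ` {..<n}\<rparr>) h"
    using isomorphism_of_atomic_equiv[OF eq e(4)] by blast
  have sub: "substructure L (F\<lparr>univ := e ` {..<n}\<rparr>) F" "substructure L (F\<lparr>univ := e' ` {..<n}\<rparr>) F"
    by (rule substructure_restrict; use F e closed_under_atomic_equiv[OF eq e(4)] in auto)+
  have fg: "finitely_generated L (F\<lparr>univ := e ` {..<n}\<rparr>)"
    "finitely_generated L (F\<lparr>univ := e' ` {..<n}\<rparr>)"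
    by (rule finitely_generated_finite; use sub in \<open>simp add: substructure_def\<close>)+
  obtain g where "isomorphism L F F g" "\<forall>a\<in>univ (F\<lparr>univ := e ` {..<n}\<rparr>). g a = h a"
    using F(2) sub fg h(2) unfolding ultrahomogeneous_def by blast
  then show thesis using that h(1) by simp
qed

text \<open>The conjunction of the atomic diagram, with negated formulas included. Conjunctions are formed
  over lists; any list that enumerates the atomic formulas will do.\<close>

definition diagram ::
  "('f, 'r) lang \<Rightarrow> nat \<Rightarrow> ('f, 'r, 'a) struct \<Rightarrow> (nat \<Rightarrow> 'a) \<Rightarrow> ('f, 'r) fm" where
  "diagram L n M e =
    Conjs (map (\<lambda>\<phi>. if sat M e \<phi> then \<phi> else Neg \<phi>) (SOME \<phi>s. set \<phi>s = atoms L n))"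

lemma diagram:
  assumes "finite (atoms L n)"
  shows wf_fm_diagram: "wf_fm L (diagram L n M e)"
    and fv_diagram: "fv (diagram L n M e) \<subseteq> {..<n}"
    and sat_diagram: "sat N e' (diagram L n M e) \<longleftrightarrow> atomic_equiv L n M e N e'"
proof -
  have "set (SOME \<phi>s. set \<phi>s = atoms L n) = atoms L n"
    by (rule someI_ex) (rule finite_list[OF assms])
  then obtain \<phi>s where \<phi>s: "set \<phi>s = atoms L n"
    "diagram L n M e = Conjs (map (\<lambda>\<phi>. if sat M e \<phi> then \<phi> else Neg \<phi>) \<phi>s)"
    by (simp add: diagram_def)
  show "wf_fm L (diagram L n M e)" using \<phi>s by (auto simp: wf_fm_Conjs wf_fm_atoms)
  show "fv (diagram L n M e) \<subseteq> {..<n}"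
    unfolding \<phi>s(2) fv_Conjs using fv_atoms[of _ L n] \<phi>s(1) by (auto split: if_splits)
  have "sat N e' (diagram L n M e) \<longleftrightarrow>
      (\<forall>\<phi>\<in>atoms L n. sat N e' (if sat M e \<phi> then \<phi> else Neg \<phi>))"
    unfolding \<phi>s(2) sat_Conjs set_map \<phi>s(1) by blast
  then show "sat N e' (diagram L n M e) \<longleftrightarrow> atomic_equiv L n M e N e'"
    by (simp add: atomic_equiv_def) blast
qed

text \<open>The extension step of a back-and-forth argument in \<open>C\<close>. In \<open>F\<close> it follows from
  ultrahomogeneity: once some tuple of \<open>F\<close> has the diagram of the longer tuple, every tuple of
  \<open>F\<close> with the diagram of the shorter one can be prolonged, by moving the first tuple with an
  automorphism. For a given pair of diagrams both the hypothesis and the conclusion of this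
  implication are first-order sentences, so it transfers to \<open>C\<close>.\<close>

lemma extend_atomic_equiv:
  fixes F :: "('f, 'r, 'b) struct" and C :: "('f, 'r, 'a) struct"
  assumes fin: "finite (dom (fun_ar L))" "finite (dom (rel_ar L))"
    and F: "is_struct L F" "ultrahomogeneous L F"
    and C: "is_struct L C" "elem_equiv L F C"
    and e: "range e \<subseteq> univ C" "range e' \<subseteq> univ C" "0 < n" "n \<le> m"
      "closed_under L C (e ` {..<n})" "atomic_equiv L n C e C e'"
  obtains e'' where "range e'' \<subseteq> univ C" "\<And>i. i < n \<Longrightarrow> e'' i = e' i" "atomic_equiv L m C e C e''"
proof -
  define \<delta> where "\<delta> = diagram L n C e"
  define \<epsilon> where "\<epsilon> = diagram L m C e"
  note \<delta> = diagram[OF finite_atoms[OF fin], where n = n and M = C and e = e, folded \<delta>_def]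
  note \<epsilon> = diagram[OF finite_atoms[OF fin], where n = m and M = C and e = e, folded \<epsilon>_def]
  \<comment> \<open>\<open>?\<sigma>\<close> denies that the longer diagram is realized;
    \<open>?\<tau>\<close> says that each realization of the shorter diagram can be prolonged.\<close>
  let ?\<chi> = "Imp \<delta> (Neg (Foralls [n..<m] (Neg \<epsilon>)))"
  let ?\<sigma> = "Foralls [0..<m] (Neg \<epsilon>)" and ?\<tau> = "Foralls [0..<n] ?\<chi>"
  have "sat C e \<epsilon>" by (simp add: \<epsilon>(3) atomic_equiv_def)
  then have "\<not> true_in C ?\<sigma>"
    unfolding true_in_Foralls unfolding true_in_def using e(1) by auto
  moreover have "sentence L ?\<sigma>" using \<epsilon>(1,2) by (auto simp: sentence_def wf_fm_Foralls fv_Foralls)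
  ultimately have "\<not> true_in F ?\<sigma>" using C(2) by (simp add: elem_equivD)
  then obtain f where f: "range f \<subseteq> univ F" "atomic_equiv L m C e F f"
    unfolding true_in_Foralls unfolding true_in_def by (auto simp: \<epsilon>(3))
  have fn: "atomic_equiv L n C e F f" using f(2) e(4) by (rule atomic_equiv_mono)
  have "true_in F ?\<tau>" unfolding true_in_Foralls unfolding true_in_def
  proof (intro allI impI)
    fix f' :: "nat \<Rightarrow> 'b" assume f': "range f' \<subseteq> univ F"
    have "\<not> sat F f' (Foralls [n..<m] (Neg \<epsilon>))" if "sat F f' \<delta>"
    proof -
      have "atomic_equiv L n F f F f'"
        using atomic_equiv_trans[OF atomic_equiv_sym[OF fn]] that by (simp add: \<delta>(3))
      then obtain g where g: "isomorphism L F F g" "\<And>i. i < n \<Longrightarrow> g (f i) = f' i"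
        using ultrahomogeneous_atomic_equiv[OF F f(1) f' e(3) closed_under_atomic_equiv[OF fn e(5)]]
        by blast
      define f'' where "f'' = (\<lambda>v. if v \<in> set [n..<m] then g (f v) else f' v)"
      have "sat F f \<epsilon>" using f(2) by (simp add: \<epsilon>(3))
      then have "sat F (g \<circ> f) \<epsilon>"
        using sat_embedding[OF F(1), of F g \<epsilon> f] g(1) \<epsilon>(1) f(1) by (auto simp: isomorphism_def)
      moreover have "sat F (g \<circ> f) \<epsilon> \<longleftrightarrow> sat F f'' \<epsilon>"
      proof (rule sat_cong)
        fix v assume "v \<in> fv \<epsilon>"
        then have "v < m" using \<epsilon>(2) by auto
        then show "(g \<circ> f) v = f'' v" using g(2)[of v] by (auto simp: f''_def)
      qed
      ultimately have "sat F f'' \<epsilon>" by simp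
      moreover have "f'' ` set [n..<m] \<subseteq> univ F"
        using g(1) f(1) by (auto simp: f''_def isomorphism_def embedding_def)
      moreover have "\<forall>v. v \<notin> set [n..<m] \<longrightarrow> f'' v = f' v" by (simp add: f''_def)
      ultimately show ?thesis unfolding sat_Foralls sat.simps by blast
    qed
    then show "sat F f' ?\<chi>" by simp
  qed
  moreover have "sentence L ?\<tau>"
    using \<delta>(1,2) \<epsilon>(1,2) by (auto simp: sentence_def wf_fm_Foralls fv_Foralls)
  ultimately have "true_in C ?\<tau>" using C(2) by (simp add: elem_equivD)
  then have "true_in C ?\<chi>" by (simp only: true_in_Foralls)
  then have "sat C e' ?\<chi>" using e(2) by (simp only: true_in_def)
  then have "\<not> sat C e' (Foralls [n..<m] (Neg \<epsilon>))" using e(6) by (simp add: \<delta>(3))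
  then obtain e'' where e'': "\<forall>v. v \<notin> set [n..<m] \<longrightarrow> e'' v = e' v" "e'' ` set [n..<m] \<subseteq> univ C"
    "sat C e'' \<epsilon>" unfolding sat_Foralls sat.simps by blast
  show thesis
  proof
    have "e'' v \<in> univ C" for v using e''(1,2) e(2) by (cases "v \<in> set [n..<m]") auto
    then show "range e'' \<subseteq> univ C" by auto
    show "e'' i = e' i" if "i < n" for i using that e''(1) by simp
    show "atomic_equiv L m C e C e''" using e''(3) by (simp add: \<epsilon>(3))
  qed
qed

definition locally_finite :: "('f, 'r) lang \<Rightarrow> ('f, 'r, 'a) struct \<Rightarrow> bool" where
  "locally_finite L M \<longleftrightarrow>
    (\<forall>S. finite S \<longrightarrow> S \<subseteq> univ M \<longrightarrow> (\<exists>D. finite D \<and> S \<subseteq> D \<and> D \<subseteq> univ M \<and> closed_under L M D))"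

lemma extend_closed_tuple:
  fixes e :: "nat \<Rightarrow> 'a"
  assumes "locally_finite L M" "range e \<subseteq> univ M" "a \<in> univ M"
  obtains m e' where "n \<le> m" "range e' \<subseteq> univ M" "closed_under L M (e' ` {..<m})"
    "a \<in> e' ` {..<m}" "\<And>i. i < n \<Longrightarrow> e' i = e i"
proof -
  have S: "finite (insert a (e ` {..<n}))" "insert a (e ` {..<n}) \<subseteq> univ M"
    using assms(2,3) by auto
  obtain D where D: "finite D" "insert a (e ` {..<n}) \<subseteq> D" "D \<subseteq> univ M" "closed_under L M D"
    using assms(1)[unfolded locally_finite_def, rule_format, OF S] by auto
  obtain xs where xs: "set xs = D" using finite_list[OF D(1)] by blast
  define e' where "e' = (\<lambda>i. if i < n then e i else if i < n + length xs then xs ! (i - n) else e 0)"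
  have im: "e' ` {..<n + length xs} = D"
  proof
    show "e' ` {..<n + length xs} \<subseteq> D" using D(2) xs by (auto simp: e'_def)
    show "D \<subseteq> e' ` {..<n + length xs}"
    proof
      fix d assume "d \<in> D"
      then obtain i where "i < length xs" "xs ! i = d" using xs by (auto simp: in_set_conv_nth)
      then show "d \<in> e' ` {..<n + length xs}" by (intro image_eqI[of _ _ "n + i"]) (auto simp: e'_def)
    qed
  qed
  show thesis
  proof (rule that)
    have "e' i \<in> univ M" for i
      using assms(2) subsetD[OF D(3), of "xs ! (i - n)"] xs[symmetric] by (auto simp: e'_def)
    then show "range e' \<subseteq> univ M" by blast
    show "closed_under L M (e' ` {..<n + length xs})" "a \<in> e' ` {..<n + length xs}"
      unfolding im using D by auto
  qed (simp_all add: e'_def)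
qed

text \<open>By closedness the value of each subterm is again an entry of the tuple, so nested terms reduce
  to the unnested equations among the atomic formulas.\<close>

lemma val_atomic_equiv:
  assumes "atomic_equiv L n M e N e'" "closed_under L M (e ` {..<n})"
    and "wf_trm L t" "\<And>v. v \<in> fv_trm t \<Longrightarrow> \<exists>i<n. f v = e i \<and> f' v = e' i"
  shows "\<exists>i<n. val M f t = e i \<and> val N f' t = e' i"
  using assms(3,4)
proof (induction t)
  case (Fun g ts)
  then have "\<forall>t\<in>set ts. \<exists>i<n. val M f t = e i \<and> val N f' t = e' i" by fastforce
  then obtain I where I: "\<And>t. t \<in> set ts \<Longrightarrow> I t < n \<and> val M f t = e (I t) \<and> val N f' t = e' (I t)"
    by metis
  define "is" where "is = map I ts"
  have vals: "map (val M f) ts = map e is" "map (val N f') ts = map e' is"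
    and "is": "set is \<subseteq> {..<n}" "fun_ar L g = Some (length is)"
    using I Fun.prems(1) by (auto simp: is_def)
  have "set (map e is) \<subseteq> e ` {..<n}" "fun_ar L g = Some (length (map e is))" using "is" by auto
  then have "fun_of M g (map e is) \<in> e ` {..<n}"
    using assms(2) unfolding closed_under_def by blast
  then obtain j where j: "j < n" "fun_of M g (map e is) = e j" by auto
  then have "fun_of N g (map e' is) = e' j"
    using atomic_equiv_Fun[OF assms(1) "is"(2,1), of j] by simp
  then show ?case unfolding val.simps vals using j by blast
qed simp

text \<open>Isomorphisms between finite substructures of \<open>C\<close> preserve all formulas, which is quantifier
  elimination in semantic form: at a quantifier the tuples are prolonged by a finite closed set that
  contains the new element. The claim is stated for assignments \<open>f\<close>, \<open>f'\<close> that take corresponding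
  values in the tuples, since the variables of \<open>\<phi>\<close> do not enumerate a closed set.\<close>

lemma sat_atomic_equiv:
  fixes F :: "('f, 'r, 'b) struct" and C :: "('f, 'r, 'a) struct"
  assumes fin: "finite (dom (fun_ar L))" "finite (dom (rel_ar L))"
    and F: "is_struct L F" "ultrahomogeneous L F"
    and C: "is_struct L C" "elem_equiv L F C" "locally_finite L C"
    and "range e \<subseteq> univ C" "range e' \<subseteq> univ C" "0 < n"
      "closed_under L C (e ` {..<n})" "atomic_equiv L n C e C e'"
    and "wf_fm L \<phi>" "\<And>v. v \<in> fv \<phi> \<Longrightarrow> \<exists>i<n. f v = e i \<and> f' v = e' i"
  shows "sat C f \<phi> \<longleftrightarrow> sat C f' \<phi>"
  using assms(8-)
proof (induction \<phi> arbitrary: n e e' f f')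
  case (Eq s t)
  obtain i where "i < n" "val C f s = e i" "val C f' s = e' i"
    using val_atomic_equiv[OF Eq.prems(5,4), of s f f'] Eq.prems by fastforce
  moreover obtain j where "j < n" "val C f t = e j" "val C f' t = e' j"
    using val_atomic_equiv[OF Eq.prems(5,4), of t f f'] Eq.prems by fastforce
  ultimately show ?case using atomic_equiv_Eq[OF Eq.prems(5), of i j] by simp
next
  case (Rel R ts)
  have "\<exists>i<n. val C f t = e i \<and> val C f' t = e' i" if "t \<in> set ts" for t
  proof (rule val_atomic_equiv[OF Rel.prems(5,4)])
    show "wf_trm L t" using Rel.prems(6) that by simp
    show "\<exists>i<n. f v = e i \<and> f' v = e' i" if "v \<in> fv_trm t" for v
      by (rule Rel.prems(7)) (use that \<open>t \<in> set ts\<close> in auto)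
  qed
  then obtain I where I: "\<And>t. t \<in> set ts \<Longrightarrow> I t < n \<and> val C f t = e (I t) \<and> val C f' t = e' (I t)"
    by metis
  have "map (val C f) ts = map e (map I ts)" "map (val C f') ts = map e' (map I ts)"
    using I by auto
  moreover have "rel_of C R (map e (map I ts)) \<longleftrightarrow> rel_of C R (map e' (map I ts))"
    by (rule atomic_equiv_Rel[OF Rel.prems(5)]) (use I Rel.prems(6) in auto)
  ultimately show ?case by (metis sat.simps(3))
next
  case (Forall k \<phi>)
  have forth: "sat C f' (Forall k \<phi>)" if ee: "range e \<subseteq> univ C" "range e' \<subseteq> univ C"
    "closed_under L C (e' ` {..<n})" "atomic_equiv L n C e' C e" "sat C f (Forall k \<phi>)"
    "\<And>v. v \<in> fv (Forall k \<phi>) \<Longrightarrow> \<exists>i<n. f v = e i \<and> f' v = e' i" for e e' f f'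
    unfolding sat.simps
  proof
    fix a assume a: "a \<in> univ C"
    obtain m d' where d': "n \<le> m" "range d' \<subseteq> univ C" "closed_under L C (d' ` {..<m})"
      "a \<in> d' ` {..<m}" "\<And>i. i < n \<Longrightarrow> d' i = e' i"
      using extend_closed_tuple[OF C(3) ee(2) a] by blast
    have "d' ` {..<n} = e' ` {..<n}" using d'(5) by auto
    moreover have "atomic_equiv L n C d' C e"
      by (rule atomic_equiv_cong[OF ee(4)]) (use d'(5) in auto)
    ultimately obtain d where d: "range d \<subseteq> univ C" "\<And>i. i < n \<Longrightarrow> d i = e i"
      "atomic_equiv L m C d' C d"
      using extend_atomic_equiv[OF fin F C(1,2) d'(2) ee(1) Forall.prems(3) d'(1)] ee(3) by metis
    obtain j where j: "j < m" "a = d' j" using d'(4) by auto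
    have "sat C (f'(k := a)) \<phi> \<longleftrightarrow> sat C (f(k := d j)) \<phi>"
    proof (rule Forall.IH[OF d'(2) d(1) _ d'(3) d(3)])
      fix v assume v: "v \<in> fv \<phi>"
      show "\<exists>i<m. (f'(k := a)) v = d' i \<and> (f(k := d j)) v = d i"
      proof (cases "v = k")
        case False
        then obtain i where "i < n" "f v = e i \<and> f' v = e' i" using ee(6)[of v] v by auto
        then show ?thesis using False d(2) d'(1,5) by (intro exI[of _ i]) auto
      qed (use j in auto)
    qed (use Forall.prems d'(1) in auto)
    moreover have "d j \<in> univ C" using d(1) by auto
    ultimately show "sat C (f'(k := a)) \<phi>" using ee(5) by simp
  qed
  have cl': "closed_under L C (e' ` {..<n})"
    using closed_under_atomic_equiv[OF Forall.prems(5,4)] .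
  show ?case
  proof
    assume "sat C f (Forall k \<phi>)"
    then show "sat C f' (Forall k \<phi>)"
      using forth[OF Forall.prems(1,2) cl' atomic_equiv_sym[OF Forall.prems(5)]] Forall.prems(7) by blast
  next
    assume "sat C f' (Forall k \<phi>)"
    then show "sat C f (Forall k \<phi>)"
      using forth[OF Forall.prems(2,1,4,5)] Forall.prems(7) by blast
  qed
next
  case (Neg \<phi>)
  have "sat C f \<phi> \<longleftrightarrow> sat C f' \<phi>"
    by (rule Neg.IH[OF Neg.prems(1-5)]) (use Neg.prems(6,7) in auto)
  then show ?case by simp
next
  case (Conj \<phi> \<psi>)
  have "sat C f \<phi> \<longleftrightarrow> sat C f' \<phi>" "sat C f \<psi> \<longleftrightarrow> sat C f' \<psi>"
    by (rule Conj.IH[OF Conj.prems(1-5)]; use Conj.prems(6,7) in auto)+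
  then show ?case by simp
qed simp

section \<open>Meet-trees and models of the starred theory\<close>

lemma true_in_elem_equiv_fraisse_limit:
  assumes F: "fraisse_limit L (finite_models L \<Theta>) F" and C: "elem_equiv L F C"
    and \<psi>: "Foralls ys \<psi> \<in> \<Theta>" "quantifier_free \<psi>" "wf_fm L \<psi>" "fv \<psi> \<subseteq> set ys"
  shows "true_in C \<psi>"
proof -
  have "true_in A \<psi>" if "A \<in> finite_models L \<Theta>" for A
  proof -
    have "true_in A (Foralls ys \<psi>)" using that \<psi>(1) unfolding finite_models_def models_def by blast
    then show ?thesis by (simp only: true_in_Foralls)
  qed
  then have "true_in F \<psi>" by (rule true_in_fraisse_limit[OF F _ \<psi>(2,3)])
  moreover have "sentence L (Foralls ys \<psi>)"
    using \<psi>(3,4) by (auto simp: sentence_def wf_fm_Foralls fv_Foralls)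
  ultimately show ?thesis using elem_equivD[OF C, of "Foralls ys \<psi>"] by (simp only: true_in_Foralls)
qed

locale meet_tree =
  fixes U :: "'a set" and le :: "'a \<Rightarrow> 'a \<Rightarrow> bool" and mt :: "'a \<Rightarrow> 'a \<Rightarrow> 'a"
  assumes refl: "x \<in> U \<Longrightarrow> le x x"
    and antisym: "\<lbrakk>x \<in> U; y \<in> U; le x y; le y x\<rbrakk> \<Longrightarrow> x = y"
    and trans: "\<lbrakk>x \<in> U; y \<in> U; z \<in> U; le x y; le y z\<rbrakk> \<Longrightarrow> le x z"
    and linear_below: "\<lbrakk>x \<in> U; y \<in> U; z \<in> U; le y x; le z x\<rbrakk> \<Longrightarrow> le y z \<or> le z y"
    and mt_in: "\<lbrakk>x \<in> U; y \<in> U\<rbrakk> \<Longrightarrow> mt x y \<in> U"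
    and mt_le1: "\<lbrakk>x \<in> U; y \<in> U\<rbrakk> \<Longrightarrow> le (mt x y) x"
    and mt_le2: "\<lbrakk>x \<in> U; y \<in> U\<rbrakk> \<Longrightarrow> le (mt x y) y"
    and mt_greatest: "\<lbrakk>x \<in> U; y \<in> U; z \<in> U; le z x; le z y\<rbrakk> \<Longrightarrow> le z (mt x y)"
begin

lemma le_mt_iff: "\<lbrakk>x \<in> U; y \<in> U; z \<in> U\<rbrakk> \<Longrightarrow> le z (mt x y) \<longleftrightarrow> le z x \<and> le z y"
  using mt_greatest[of x y z] trans[of z "mt x y" x] trans[of z "mt x y" y]
    mt_in[of x y] mt_le1[of x y] mt_le2[of x y] by auto

lemma mt_eqI:
  assumes "x \<in> U" "y \<in> U" "\<And>z. z \<in> U \<Longrightarrow> le z x \<longleftrightarrow> le z y"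
  shows "x = y"
  using assms(3)[of x] assms(3)[of y] assms(1,2) refl[of x] refl[of y] by (auto intro: antisym)

lemma le_iff_mt: "\<lbrakk>x \<in> U; y \<in> U\<rbrakk> \<Longrightarrow> le x y \<longleftrightarrow> mt x y = x"
  using mt_le2[of x y] antisym[of "mt x y" x] mt_in[of x y] mt_le1[of x y] mt_greatest[of x y x]
    refl[of x] by auto

lemma mt_idem: "x \<in> U \<Longrightarrow> mt x x = x"
  using le_iff_mt[of x x] refl[of x] by simp

lemma mt_commute: "\<lbrakk>x \<in> U; y \<in> U\<rbrakk> \<Longrightarrow> mt x y = mt y x"
  by (rule mt_eqI) (auto simp: mt_in le_mt_iff)

lemma mt_assoc: "\<lbrakk>x \<in> U; y \<in> U; z \<in> U\<rbrakk> \<Longrightarrow> mt (mt x y) z = mt x (mt y z)"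
  by (rule mt_eqI) (auto simp: mt_in le_mt_iff)

lemma mt_left_commute: "\<lbrakk>x \<in> U; y \<in> U; z \<in> U\<rbrakk> \<Longrightarrow> mt x (mt y z) = mt y (mt x z)"
  by (rule mt_eqI) (auto simp: mt_in le_mt_iff)

lemma mt_left_idem: "\<lbrakk>x \<in> U; y \<in> U\<rbrakk> \<Longrightarrow> mt x (mt x y) = mt x y"
  by (rule mt_eqI) (auto simp: mt_in le_mt_iff)

definition mt_closed :: "'a set \<Rightarrow> bool" where
  "mt_closed D \<longleftrightarrow> (\<forall>x\<in>D. \<forall>y\<in>D. mt x y \<in> D)"

text \<open>Adjoining one element requires only its meets with the given elements, as
  \<open>(a \<and> x) \<and> (a \<and> y) = a \<and> (x \<and> y)\<close>. This makes meet-trees locally finite.\<close>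

lemma mt_closed_adjoin:
  assumes "mt_closed D" "D \<subseteq> U" "a \<in> U"
  shows "mt_closed (insert a (D \<union> mt a ` D))"
proof -
  have D: "mt x y \<in> D" if "x \<in> D" "y \<in> D" for x y
    using assms that by (simp add: mt_closed_def)
  have U: "x \<in> U" if "x \<in> D" for x using assms that by blast
  have "mt x y \<in> insert a (D \<union> mt a ` D)"
    if "x = a \<or> x \<in> D \<or> (\<exists>x'\<in>D. x = mt a x')" "y = a \<or> y \<in> D \<or> (\<exists>y'\<in>D. y = mt a y')" for x y
    using that D U assms(3)
    by (elim disjE bexE)
      (simp_all add: mt_in mt_idem mt_assoc mt_left_idem mt_commute[of _ a] mt_left_commute[of _ a])
  then show ?thesis unfolding mt_closed_def by (simp add: image_iff)
qed

lemma finite_mt_closed_hull: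
  assumes "finite S" "S \<subseteq> U"
  obtains D where "finite D" "S \<subseteq> D" "D \<subseteq> U" "mt_closed D" "\<And>d. d \<in> D \<Longrightarrow> \<exists>s\<in>S. le d s"
proof -
  have "\<exists>D. finite D \<and> S \<subseteq> D \<and> D \<subseteq> U \<and> mt_closed D \<and> (\<forall>d\<in>D. \<exists>s\<in>S. le d s)"
    using assms
  proof (induction S)
    case empty
    show ?case by (intro exI[of _ "{}"]) (simp add: mt_closed_def)
  next
    case (insert a S)
    then obtain D where D: "finite D" "S \<subseteq> D" "D \<subseteq> U" "mt_closed D" "\<forall>d\<in>D. \<exists>s\<in>S. le d s"
      by auto
    have a: "a \<in> U" using insert.prems by simp
    show ?case
    proof (intro exI[of _ "insert a (D \<union> mt a ` D)"] conjI)
      show "mt_closed (insert a (D \<union> mt a ` D))" using D a by (intro mt_closed_adjoin)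
      show "\<forall>d\<in>insert a (D \<union> mt a ` D). \<exists>s\<in>insert a S. le d s"
        using D(3,5) a refl mt_le1 by fastforce
    qed (use D a mt_in in auto)
  qed
  then show thesis using that by blast
qed

text \<open>Both \<open>b\<close> and \<open>c \<and> d\<close> lie below \<open>c\<close>, hence are comparable. As \<open>b\<close> is not below \<open>d\<close>,
  it follows that \<open>c \<and> d \<le> b\<close>. So all elements above \<open>b\<close> look alike from \<open>d\<close>.\<close>

lemma mt_eq_above:
  assumes "b \<in> U" "c \<in> U" "d \<in> U" "le b c" "\<not> le b d"
  shows "mt c d = mt b d"
proof (rule antisym)
  note U = assms(1-3)
  have "\<not> le b (mt c d)" using U assms(5) by (simp add: le_mt_iff)
  then have "le (mt c d) b"
    using U assms(4) linear_below[of c b "mt c d"] mt_in[of c d] mt_le1[of c d] by blast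
  then show "le (mt c d) (mt b d)" using U mt_le2[of c d] by (simp add: mt_in le_mt_iff)
  have "le (mt b d) c" using U assms(4) trans[of "mt b d" b c] mt_in[of b d] mt_le1[of b d] by blast
  then show "le (mt b d) (mt c d)" using U mt_le2[of b d] by (simp add: mt_in le_mt_iff)
qed (use assms mt_in in auto)

end

abbreviation leq :: "('f, 'r star_sym, 'a) struct \<Rightarrow> 'a \<Rightarrow> 'a \<Rightarrow> bool" where
  "leq C x y \<equiv> rel_of C Leq [x, y]"

abbreviation inf_of :: "(tree_fun, 'r, 'a) struct \<Rightarrow> 'a \<Rightarrow> 'a \<Rightarrow> 'a" where
  "inf_of C x y \<equiv> fun_of C Meet [x, y]"

lemma fun_ar_star_lang: "fun_ar (star_lang L) f = Some 2"
  by (simp add: star_lang_def)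

lemma rel_ar_star_lang:
  "rel_ar (star_lang L) Leq = Some 2"
  "rel_ar (star_lang L) (Star R) = map_option Suc (rel_ar L R)"
  by (simp_all add: star_lang_def)

lemma finite_star_lang:
  assumes "finite_relational L"
  shows "finite (dom (fun_ar (star_lang L)))" "finite (dom (rel_ar (star_lang L)))"
proof -
  have "f = Meet" for f by (cases f)
  then have "dom (fun_ar (star_lang L)) \<subseteq> {Meet}" by blast
  then show "finite (dom (fun_ar (star_lang L)))" by (rule finite_subset) simp
  have "R \<in> insert Leq (Star ` dom (rel_ar L))" if "R \<in> dom (rel_ar (star_lang L))" for R
    using that by (cases R) (auto simp: rel_ar_star_lang image_iff dom_def)
  then have "dom (rel_ar (star_lang L)) \<subseteq> insert Leq (Star ` dom (rel_ar L))" by blast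
  then show "finite (dom (rel_ar (star_lang L)))"
    by (rule finite_subset) (use assms in \<open>simp add: finite_relational_def\<close>)
qed

lemma closed_under_star_lang:
  "closed_under (star_lang L) C X \<longleftrightarrow> (\<forall>x\<in>X. \<forall>y\<in>X. inf_of C x y \<in> X)"
proof
  assume cl: "closed_under (star_lang L) C X"
  show "\<forall>x\<in>X. \<forall>y\<in>X. inf_of C x y \<in> X"
  proof (intro ballI)
    fix x y assume "x \<in> X" "y \<in> X"
    then show "inf_of C x y \<in> X"
      using cl[unfolded closed_under_def, rule_format, of Meet "[x, y]"]
      by (simp add: fun_ar_star_lang)
  qed
next
  assume cl: "\<forall>x\<in>X. \<forall>y\<in>X. inf_of C x y \<in> X"
  show "closed_under (star_lang L) C X" unfolding closed_under_def
  proof (intro allI impI)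
    fix f and as :: "'b list"
    assume "fun_ar (star_lang L) f = Some (length as)" and as: "set as \<subseteq> X"
    then have "length as = Suc (Suc 0)" by (simp add: fun_ar_star_lang)
    then obtain x y where "as = [x, y]" by (auto simp: length_Suc_conv)
    then show "fun_of C f as \<in> X" using cl as by (cases f) simp
  qed
qed

text \<open>The consequences of the starred theory that matter below: the tree axioms, (WD) and (OC),
  freed from their coding as formulas.\<close>

locale star_model =
  meet_tree "univ C" "leq C" "inf_of C"
  for L :: "(tree_fun, 'r) lang" and C :: "(tree_fun, 'r star_sym, 'a) struct" +
  assumes rel_ar_pos: "rel_ar L R \<noteq> Some 0"
    and well_defined: "\<lbrakk>rel_ar L R = Some (length ys); length ys' = length ys; x \<in> univ C;
      set ys \<subseteq> univ C; set ys' \<subseteq> univ C; rel_of C (Star R) (x # ys);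
      \<And>i. i < length ys \<Longrightarrow> leq C x (inf_of C (ys ! i) (ys' ! i)) \<and> x \<noteq> inf_of C (ys ! i) (ys' ! i)\<rbrakk>
      \<Longrightarrow> rel_of C (Star R) (x # ys')"
    and open_cone: "\<lbrakk>rel_ar L R = Some (length ys); x \<in> univ C; set ys \<subseteq> univ C;
      rel_of C (Star R) (x # ys); y \<in> set ys\<rbrakk> \<Longrightarrow> leq C x y \<and> x \<noteq> y"

context
  fixes L :: "(tree_fun, 'r) lang" and T F and C :: "(tree_fun, 'r star_sym, 'a) struct"
  assumes F: "fraisse_limit (star_lang L) (finite_models (star_lang L) (star_theory L T)) F"
    and C: "is_struct (star_lang L) C" "elem_equiv (star_lang L) F C"
begin

lemma star_axiom_true:
  assumes "Foralls ys \<psi> \<in> star_theory L T" "quantifier_free \<psi>" "wf_fm (star_lang L) \<psi>"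
    "fv \<psi> \<subseteq> set ys" "range e \<subseteq> univ C"
  shows "sat C e \<psi>"
  using true_in_elem_equiv_fraisse_limit[OF F C(2) assms(1-4)] assms(5) by (simp add: true_in_def)

lemma meet_tree_of_fraisse_limit: "meet_tree (univ C) (leq C) (inf_of C)"
proof
  have cl: "closed_under (star_lang L) C (univ C)"
    using C(1) by (simp add: is_struct_def closed_under_def)
  then show "inf_of C x y \<in> univ C" if "x \<in> univ C" "y \<in> univ C" for x y
    using that by (simp add: closed_under_star_lang)
  note simps = star_theory_def Tr_def Let_def fun_ar_star_lang rel_ar_star_lang
  define env where "env x y z = (\<lambda>i :: nat. if i = 0 then x else if i = 1 then y else z)" for x y z :: 'a
  have env: "range (env x y z) \<subseteq> univ C" if "x \<in> univ C" "y \<in> univ C" "z \<in> univ C" for x y z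
    using that by (auto simp: env_def)
  show "leq C x x" if "x \<in> univ C" for x
    using star_axiom_true[of "[0]" "Le (Var 0) (Var 0)", OF _ _ _ _ env[OF that that that]]
    by (simp add: simps env_def)
  show "x = y" if "x \<in> univ C" "y \<in> univ C" "leq C x y" "leq C y x" for x y
    using star_axiom_true[of "[0, 1]"
        "Imp (Conj (Le (Var 0) (Var 1)) (Le (Var 1) (Var 0))) (Eq (Var 0) (Var 1))",
        OF _ _ _ _ env[OF that(1,2,2)]] that
    by (simp add: simps env_def)
  show "leq C x z" if "x \<in> univ C" "y \<in> univ C" "z \<in> univ C" "leq C x y" "leq C y z" for x y z
    using star_axiom_true[of "[0, 1, 2]"
        "Imp (Conj (Le (Var 0) (Var 1)) (Le (Var 1) (Var 2))) (Le (Var 0) (Var 2))",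
        OF _ _ _ _ env[OF that(1,2,3)]] that
    by (simp add: simps env_def)
  show "leq C y z \<or> leq C z y"
    if "x \<in> univ C" "y \<in> univ C" "z \<in> univ C" "leq C y x" "leq C z x" for x y z
    using star_axiom_true[of "[0, 1, 2]"
        "Imp (Conj (Le (Var 1) (Var 0)) (Le (Var 2) (Var 0)))
          (Disj (Le (Var 1) (Var 2)) (Le (Var 2) (Var 1)))",
        OF _ _ _ _ env[OF that(1,2,3)]] that
    by (simp add: simps env_def)
  have "leq C (inf_of C x y) x \<and> leq C (inf_of C x y) y" if "x \<in> univ C" "y \<in> univ C" for x y
    using star_axiom_true[of "[0, 1]"
        "Conj (Le (meet (Var 0) (Var 1)) (Var 0)) (Le (meet (Var 0) (Var 1)) (Var 1))",
        OF _ _ _ _ env[OF that(1,2,2)]] that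
    by (simp add: simps env_def)
  then show "leq C (inf_of C x y) x" "leq C (inf_of C x y) y"
    if "x \<in> univ C" "y \<in> univ C" for x y using that by auto
  show "leq C z (inf_of C x y)"
    if "x \<in> univ C" "y \<in> univ C" "z \<in> univ C" "leq C z x" "leq C z y" for x y z
    using star_axiom_true[of "[0, 1, 2]"
        "Imp (Conj (Le (Var 2) (Var 0)) (Le (Var 2) (Var 1))) (Le (Var 2) (meet (Var 0) (Var 1)))",
        OF _ _ _ _ env[OF that(1,2,3)]] that
    by (simp add: simps env_def)
qed

lemma star_model_of_fraisse_limit:
  assumes L: "finite_relational L"
  shows "star_model L C"
proof -
  interpret meet_tree "univ C" "leq C" "inf_of C" by (rule meet_tree_of_fraisse_limit)
  show ?thesis
  proof
    show "rel_ar L R \<noteq> Some 0" for R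
      using L by (auto simp: finite_relational_def ran_def)
  next
    fix R ys ys' x
    assume R: "rel_ar L R = Some (length ys)" and len: "length ys' = length ys"
      and U: "x \<in> univ C" "set ys \<subseteq> univ C" "set ys' \<subseteq> univ C"
      and R_ys: "rel_of C (Star R) (x # ys)"
      and lt: "\<And>i. i < length ys \<Longrightarrow>
        leq C x (inf_of C (ys ! i) (ys' ! i)) \<and> x \<noteq> inf_of C (ys ! i) (ys' ! i)"
    let ?n = "length ys"
    define y where "y = (\<lambda>i. Var (1 + i) :: tree_fun trm)"
    define y' where "y' = (\<lambda>i. Var (1 + ?n + i) :: tree_fun trm)"
    define \<psi> :: "(tree_fun, 'r star_sym) fm" where "\<psi> = Imp (Conj (Rel (Star R) (Var 0 # map y [0..<?n]))
                 (Conjs (map (\<lambda>i. Lt (Var 0) (meet (y i) (y' i))) [0..<?n])))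
           (Rel (Star R) (Var 0 # map y' [0..<?n]))"
    define e where "e = (\<lambda>i. if i = 0 \<or> i > ?n + ?n then x else if i \<le> ?n then ys ! (i - 1)
      else ys' ! (i - 1 - ?n))"
    have vals: "map (val C e) (map y [0..<?n]) = ys" "map (val C e) (map y' [0..<?n]) = ys'"
      using len by (auto simp: y_def y'_def e_def intro!: nth_equalityI)
    have "sat C e \<psi>"
    proof (rule star_axiom_true)
      have "Foralls [0..<1 + ?n + ?n] \<psi> = WD R ?n"
        by (simp add: WD_def \<psi>_def y_def y'_def Let_def)
      then show "Foralls [0..<1 + ?n + ?n] \<psi> \<in> star_theory L T"
        using R by (auto simp: star_theory_def)
      show "quantifier_free \<psi>" by (auto simp: \<psi>_def quantifier_free_Conjs)
      show "wf_fm (star_lang L) \<psi>"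
        using R by (auto simp: \<psi>_def y_def y'_def wf_fm_Conjs rel_ar_star_lang fun_ar_star_lang)
      show "fv \<psi> \<subseteq> set [0..<1 + ?n + ?n]" by (auto simp: \<psi>_def y_def y'_def fv_Conjs)
      have "e i \<in> univ C" for i
        using U len nth_mem[of "i - 1" ys] nth_mem[of "i - 1 - ?n" ys'] by (auto simp: e_def)
      then show "range e \<subseteq> univ C" by auto
    qed
    moreover have "sat C e (Conjs (map (\<lambda>i. Lt (Var 0) (meet (y i) (y' i))) [0..<?n]))"
      using lt by (auto simp: sat_Conjs y_def y'_def e_def)
    ultimately have "rel_of C (Star R) (e 0 # map (val C e) (map y' [0..<?n]))"
      using R_ys vals(1) unfolding \<psi>_def sat.simps list.map(2) val.simps by (simp add: e_def)
    then show "rel_of C (Star R) (x # ys')" unfolding vals by (simp add: e_def)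
  next
    fix R ys x z
    assume R: "rel_ar L R = Some (length ys)"
      and U: "x \<in> univ C" "set ys \<subseteq> univ C"
      and R_ys: "rel_of C (Star R) (x # ys)" and z: "z \<in> set ys"
    let ?n = "length ys"
    define y where "y = (\<lambda>i. Var (1 + i) :: tree_fun trm)"
    define \<psi> :: "(tree_fun, 'r star_sym) fm" where "\<psi> = Imp (Rel (Star R) (Var 0 # map y [0..<?n]))
                 (Conjs (map (\<lambda>i. Lt (Var 0) (y i)) [0..<?n]))"
    define e where "e = (\<lambda>i. if i = 0 \<or> i > ?n then x else ys ! (i - 1))"
    have vals: "map (val C e) (map y [0..<?n]) = ys"
      by (auto simp: y_def e_def intro!: nth_equalityI)
    have "sat C e \<psi>"
    proof (rule star_axiom_true)
      have "Foralls [0..<1 + ?n] \<psi> = OC R ?n"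
        by (simp add: OC_def \<psi>_def y_def Let_def)
      then show "Foralls [0..<1 + ?n] \<psi> \<in> star_theory L T"
        using R by (auto simp: star_theory_def)
      show "quantifier_free \<psi>" by (auto simp: \<psi>_def quantifier_free_Conjs)
      show "wf_fm (star_lang L) \<psi>"
        using R by (auto simp: \<psi>_def y_def wf_fm_Conjs rel_ar_star_lang fun_ar_star_lang)
      show "fv \<psi> \<subseteq> set [0..<1 + ?n]" by (auto simp: \<psi>_def y_def fv_Conjs)
      have "e i \<in> univ C" for i
        using U nth_mem[of "i - 1" ys] by (auto simp: e_def)
      then show "range e \<subseteq> univ C" by auto
    qed
    then have "sat C e (Conjs (map (\<lambda>i. Lt (Var 0) (y i)) [0..<?n]))"
      using R_ys vals unfolding \<psi>_def sat.simps list.map(2) val.simps by (simp add: e_def)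
    moreover obtain i where "i < ?n" "z = ys ! i" using z by (auto simp: in_set_conv_nth)
    ultimately show "leq C x z \<and> x \<noteq> z" by (auto simp: sat_Conjs y_def e_def)
  qed
qed

end

section \<open>Exchanging a point of a finite subtree\<close>

context star_model
begin

lemma locally_finite_star: "locally_finite (star_lang L) C"
  unfolding locally_finite_def
proof (intro allI impI)
  fix S assume S: "finite S" "S \<subseteq> univ C"
  obtain D where D: "finite D" "S \<subseteq> D" "D \<subseteq> univ C" "mt_closed D"
    by (rule finite_mt_closed_hull[OF S])
  show "\<exists>D. finite D \<and> S \<subseteq> D \<and> D \<subseteq> univ C \<and> closed_under (star_lang L) C D"
    by (rule exI[of _ D]) (use D in \<open>simp add: closed_under_star_lang mt_closed_def\<close>)
qed

text \<open>An injective map that preserves meets also preserves the order, as \<open>x \<le> y\<close> means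
  \<open>x \<and> y = x\<close>.\<close>

lemma embedding_starI:
  assumes D: "D \<subseteq> univ C" "h ` D \<subseteq> univ C" "inj_on h D" "mt_closed D"
    and mt: "\<And>x y. x \<in> D \<Longrightarrow> y \<in> D \<Longrightarrow> h (inf_of C x y) = inf_of C (h x) (h y)"
    and star: "\<And>R x ys. rel_ar L R = Some (length ys) \<Longrightarrow> x \<in> D \<Longrightarrow> set ys \<subseteq> D \<Longrightarrow>
      rel_of C (Star R) (x # ys) \<longleftrightarrow> rel_of C (Star R) (h x # map h ys)"
  shows "embedding (star_lang L) (C\<lparr>univ := D\<rparr>) C h"
proof -
  have mt_D: "inf_of C x y \<in> D" if "x \<in> D" "y \<in> D" for x y
    using D(4) that by (simp add: mt_closed_def)
  have fun_h: "h (fun_of C f as) = fun_of C f (map h as)"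
    if "fun_ar (star_lang L) f = Some (length as)" "set as \<subseteq> D" for f as
  proof -
    have "length as = Suc (Suc 0)" using that(1) by (simp add: fun_ar_star_lang)
    then obtain x y where "as = [x, y]" by (auto simp: length_Suc_conv)
    then show ?thesis using that(2) mt by (cases f) simp
  qed
  have le_h: "leq C x y \<longleftrightarrow> leq C (h x) (h y)" if xy: "x \<in> D" "y \<in> D" for x y
  proof -
    have "leq C x y \<longleftrightarrow> inf_of C x y = x" using D(1) xy by (intro le_iff_mt) auto
    also have "\<dots> \<longleftrightarrow> h (inf_of C x y) = h x" using D(3) xy mt_D inj_on_eq_iff by metis
    also have "\<dots> \<longleftrightarrow> leq C (h x) (h y)"
      unfolding mt[OF xy] using D(2) xy by (intro le_iff_mt[symmetric]) auto
    finally show ?thesis .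
  qed
  have rel_h: "rel_of C R as \<longleftrightarrow> rel_of C R (map h as)"
    if as: "rel_ar (star_lang L) R = Some (length as)" "set as \<subseteq> D" for R as
  proof (cases R)
    case Leq
    then have "length as = Suc (Suc 0)" using as(1) by (simp add: rel_ar_star_lang)
    then obtain x y where "as = [x, y]" by (auto simp: length_Suc_conv)
    then show ?thesis using as(2) Leq le_h[of x y] by simp
  next
    case (Star R')
    then obtain k where k: "rel_ar L R' = Some k" "Suc k = length as"
      using as(1) by (auto simp: rel_ar_star_lang)
    then obtain x ys where "as = x # ys" "length ys = k" by (cases as) auto
    then show ?thesis using star[of R' ys x] k(1) as(2) Star by simp
  qed
  show ?thesis using D(2,3) fun_h rel_h by (simp add: embedding_def)
qed

text \<open>On a single point every starred relation is empty: by (OC) it would require the point to be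
  strictly below itself.\<close>

lemma embedding_singleton:
  assumes "a \<in> univ C" "a' \<in> univ C"
  shows "embedding (star_lang L) (C\<lparr>univ := {a}\<rparr>) C (\<lambda>_. a')"
proof (rule embedding_starI)
  show "mt_closed {a}" using assms mt_idem by (simp add: mt_closed_def)
  fix R x and ys :: "'a list"
  assume R: "rel_ar L R = Some (length ys)" "x \<in> {a}" "set ys \<subseteq> {a}"
  then have "ys \<noteq> []" using rel_ar_pos[of R] by auto
  then obtain y where y: "y \<in> set ys" by (cases ys) auto
  have ys': "map (\<lambda>_. a') ys = replicate (length ys) a'" by (simp add: map_replicate_const)
  have "\<not> rel_of C (Star R) (x # ys)" using open_cone[of R ys x y] R y assms by auto
  moreover have "\<not> rel_of C (Star R) (a' # map (\<lambda>_. a') ys)"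
    using open_cone[of R "map (\<lambda>_. a') ys" a' a'] R y assms by auto
  ultimately show "rel_of C (Star R) (x # ys) \<longleftrightarrow> rel_of C (Star R) (a' # map (\<lambda>_. a') ys)" by simp
qed (use assms mt_idem in auto)

text \<open>The heart of the argument: in a finite subtree where nothing else lies above \<open>b\<close>, the point \<open>b\<close>
  can be replaced by any \<open>c\<close> above it. Meets do not change by \<open>mt_eq_above\<close>. A starred relation
  with first argument \<open>b\<close>, respectively \<open>c\<close>, fails by (OC), as it has at least one
  further argument and nothing in the subtree lies strictly above the first. If the first argument
  \<open>x\<close> is another point and \<open>b\<close> or \<open>c\<close> occurs, then (OC) puts \<open>x\<close> strictly below it, hence
  strictly below \<open>b\<close>; since \<open>b \<and> c = b\<close>, the two points lie in the same open cone above
  \<open>x\<close>, and (WD) allows one to be exchanged for the other.\<close>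

lemma embedding_move_top:
  assumes E: "E \<subseteq> univ C" "mt_closed (insert b E)" and bc: "b \<in> univ C" "c \<in> univ C"
    and le: "leq C b c" "\<And>d. d \<in> E \<Longrightarrow> \<not> leq C b d"
  shows "embedding (star_lang L) (C\<lparr>univ := insert b E\<rparr>) C (id(b := c))"
proof -
  let ?h = "id(b := c)"
  have b: "b \<notin> E" "c \<notin> E" using le refl[OF bc(1)] by auto
  have h: "?h x = x" if "x \<in> E" for x using that b(1) by auto
  have U: "x \<in> univ C" if "x \<in> E" for x using that E(1) by auto
  have mt_E: "inf_of C x y \<in> E" if x: "x \<in> E" and y: "y \<in> insert b E" for x y
  proof -
    have yU: "y \<in> univ C" using y U bc by auto
    have "inf_of C x y \<noteq> b" using mt_le1[OF U[OF x] yU] le(2)[OF x] by auto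
    then show ?thesis using E(2) x y unfolding mt_closed_def by blast
  qed
  have mt_c: "inf_of C c x = inf_of C b x" if "x \<in> E" for x
    using mt_eq_above[OF bc U[OF that] le(1)] le(2)[OF that] by simp
  have comm: "inf_of C x z = inf_of C z x" if "x \<in> E" "z = b \<or> z = c" for x z
    using that U bc mt_commute by blast
  show ?thesis
  proof (rule embedding_starI)
    show "insert b E \<subseteq> univ C" "?h ` insert b E \<subseteq> univ C" using E bc by auto
    show "inj_on ?h (insert b E)" using b by (auto simp: inj_on_def)
    show "mt_closed (insert b E)" by fact
    show "?h (inf_of C x y) = inf_of C (?h x) (?h y)" if "x \<in> insert b E" "y \<in> insert b E" for x y
    proof (cases "x = b")
      case True
      show ?thesis
      proof (cases "y = b")
        case y: True
        show ?thesis using bc mt_idem True y by simp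
      next
        case False
        then have y: "y \<in> E" using that by simp
        have "inf_of C b y \<in> E" using mt_E[OF y, of b] comm[OF y, of b] by simp
        then show ?thesis using True h y mt_c[OF y] by simp
      qed
    next
      case False
      then have x: "x \<in> E" using that by simp
      have "?h (inf_of C x y) = inf_of C x y" using h mt_E[OF x that(2)] by blast
      moreover have "inf_of C x b = inf_of C x c" using comm[OF x] mt_c[OF x] by simp
      ultimately show ?thesis using x h that(2) by auto
    qed
  next
    fix R x and ys :: "'a list"
    assume R: "rel_ar L R = Some (length ys)" and x: "x \<in> insert b E" and ys: "set ys \<subseteq> insert b E"
    have ys_U: "set ys \<subseteq> univ C" "set (map ?h ys) \<subseteq> univ C" using ys U bc by auto
    show "rel_of C (Star R) (x # ys) \<longleftrightarrow> rel_of C (Star R) (?h x # map ?h ys)"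
    proof (cases "x = b")
      case True
      have "ys \<noteq> []" using rel_ar_pos[of R] R by auto
      then obtain y where y: "y \<in> set ys" by (cases ys) auto
      have "\<not> rel_of C (Star R) (b # ys)"
        using open_cone[OF R bc(1) ys_U(1) _ y] le(2) y ys by auto
      moreover have "\<not> rel_of C (Star R) (c # map ?h ys)"
      proof
        assume "rel_of C (Star R) (c # map ?h ys)"
        then have cy: "leq C c (?h y) \<and> c \<noteq> ?h y"
          using open_cone[OF _ bc(2) ys_U(2), of R "?h y"] R y by simp
        then have "y \<noteq> b" by auto
        then have y_E: "y \<in> E" using ys y by blast
        then have "leq C c y" using cy h by simp
        then have "leq C b y" using trans[OF bc U[OF y_E] le(1)] by simp
        then show False using le(2)[OF y_E] by simp
      qed
      ultimately show ?thesis using True by simp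
    next
      case False
      then have x_E: "x \<in> E" using x by simp
      have x_U: "x \<in> univ C" using U[OF x_E] .
      have mt_b: "inf_of C b c = b" "inf_of C c b = b"
        using le(1) bc le_iff_mt[of b c] mt_commute[of c b] by auto
      have below_c: "leq C x b \<and> x \<noteq> b" if "leq C x c"
      proof -
        have "inf_of C x c = x" using le_iff_mt[OF x_U bc(2)] that by simp
        then have "inf_of C x b = x" using comm[OF x_E] mt_c[OF x_E] by simp
        then show ?thesis using le_iff_mt[OF x_U bc(1)] False by simp
      qed
      have mt_y: "leq C x (inf_of C y (?h y)) \<and> x \<noteq> inf_of C y (?h y) \<and>
          leq C x (inf_of C (?h y) y) \<and> x \<noteq> inf_of C (?h y) y"
        if y: "y \<in> insert b E" "(leq C x y \<and> x \<noteq> y) \<or> (leq C x (?h y) \<and> x \<noteq> ?h y)" for y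
      proof (cases "y = b")
        case True
        then have "leq C x b \<and> x \<noteq> b" using y(2) below_c by auto
        then show ?thesis using True mt_b by simp
      next
        case False
        then have "y \<in> E" using y(1) by simp
        then have "?h y = y" "inf_of C y y = y" using h U mt_idem by blast+
        then show ?thesis using y(2) by simp
      qed
      show ?thesis
      proof
        assume r: "rel_of C (Star R) (x # ys)"
        have "rel_of C (Star R) (x # map ?h ys)"
        proof (rule well_defined[OF R _ x_U ys_U r])
          fix i assume i: "i < length ys"
          then have "leq C x (ys ! i) \<and> x \<noteq> ys ! i" using open_cone[OF R x_U ys_U(1) r] by simp
          then show "leq C x (inf_of C (ys ! i) (map ?h ys ! i)) \<and> x \<noteq> inf_of C (ys ! i) (map ?h ys ! i)"
            using mt_y[of "ys ! i"] i ys nth_mem[OF i] by (simp only: nth_map) blast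
        qed simp
        then show "rel_of C (Star R) (?h x # map ?h ys)" using h[OF x_E] by simp
      next
        assume "rel_of C (Star R) (?h x # map ?h ys)"
        then have r: "rel_of C (Star R) (x # map ?h ys)" using h[OF x_E] by simp
        have R': "rel_ar L R = Some (length (map ?h ys))" using R by simp
        show "rel_of C (Star R) (x # ys)"
        proof (rule well_defined[OF R' _ x_U ys_U(2,1) r])
          fix i assume "i < length (map ?h ys)"
          then have i: "i < length ys" by simp
          have "?h (ys ! i) \<in> set (map ?h ys)" unfolding set_map by (intro imageI nth_mem i)
          then have "leq C x (?h (ys ! i)) \<and> x \<noteq> ?h (ys ! i)"
            using open_cone[OF R' x_U ys_U(2) r] by blast
          then show "leq C x (inf_of C (map ?h ys ! i) (ys ! i)) \<and> x \<noteq> inf_of C (map ?h ys ! i) (ys ! i)"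
            using mt_y[of "ys ! i"] i ys nth_mem[OF i] by (simp only: nth_map) blast
        qed simp
      qed
    qed
  qed
qed

end

lemma atomic_equiv_embedding:
  assumes C: "is_struct L C" and D: "e ` {..<n} = D" "0 < n" "D \<subseteq> univ C" "closed_under L C D"
    and h: "embedding L (C\<lparr>univ := D\<rparr>) C h"
  shows "atomic_equiv L n C e C (h \<circ> e)"
  unfolding atomic_equiv_def
proof
  fix \<phi> assume \<phi>: "\<phi> \<in> atoms L n"
  have "D \<noteq> {}" using D(1,2) by auto
  then have sub: "substructure L (C\<lparr>univ := D\<rparr>) C" using C D by (intro substructure_restrict)
  have e: "e v \<in> univ (C\<lparr>univ := D\<rparr>)" if "v \<in> fv \<phi>" for v
    using fv_atoms[OF \<phi>] that D(1) by auto
  have "sat (C\<lparr>univ := D\<rparr>) e \<phi> \<longleftrightarrow> sat C (k \<circ> e) \<phi>" if "embedding L (C\<lparr>univ := D\<rparr>) C k" for k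
    using sat_embedding[OF _ that, of \<phi> e] sub wf_fm_atoms[OF \<phi>] quantifier_free_atoms[OF \<phi>] e
    by (simp add: substructure_def)
  from this[of id] this[OF h] show "sat C e \<phi> \<longleftrightarrow> sat C (h \<circ> e) \<phi>"
    using sub by (simp add: substructure_def)
qed

text \<open>The tuple statement \<open>sat_atomic_equiv\<close> for a map on a finite closed set, by enumerating it.\<close>

lemma sat_partial_isomorphism:
  fixes F :: "('f, 'r, 'b) struct" and C :: "('f, 'r, 'a) struct"
  assumes fin: "finite (dom (fun_ar L))" "finite (dom (rel_ar L))"
    and F: "is_struct L F" "ultrahomogeneous L F"
    and C: "is_struct L C" "elem_equiv L F C" "locally_finite L C"
    and D: "finite D" "D \<noteq> {}" "D \<subseteq> univ C" "closed_under L C D"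
    and h: "embedding L (C\<lparr>univ := D\<rparr>) C h"
    and \<phi>: "wf_fm L \<phi>" "\<And>v. v \<in> fv \<phi> \<Longrightarrow> f v \<in> D"
  shows "sat C f \<phi> \<longleftrightarrow> sat C (h \<circ> f) \<phi>"
proof -
  obtain xs where xs: "set xs = D" using finite_list[OF D(1)] by blast
  then have n: "0 < length xs" using D(2) by auto
  define e where "e = (\<lambda>i. if i < length xs then xs ! i else xs ! 0)"
  have e: "e ` {..<length xs} = D" "range e \<subseteq> D"
    using xs n by (auto simp: e_def in_set_conv_nth image_iff intro: nth_mem)
  have h_D: "h ` D \<subseteq> univ C" using h by (simp add: embedding_def)
  show ?thesis
  proof (rule sat_atomic_equiv[OF fin F C _ _ n _ _ \<phi>(1)])
    show "range e \<subseteq> univ C" "range (h \<circ> e) \<subseteq> univ C" using e(2) D(3) h_D by auto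
    show "closed_under L C (e ` {..<length xs})" using e(1) D(4) by simp
    show "atomic_equiv L (length xs) C e C (h \<circ> e)"
      by (rule atomic_equiv_embedding[OF C(1) e(1) n D(3,4) h])
    fix v assume "v \<in> fv \<phi>"
    then have "f v \<in> e ` {..<length xs}" using \<phi>(2) e(1) by simp
    then show "\<exists>i<length xs. f v = e i \<and> (h \<circ> f) v = (h \<circ> e) i" by auto
  qed
qed

section \<open>Types that are finitely satisfiable in a set do not fork over it\<close>

text \<open>In a parametrized formula variable \<open>0\<close> stands for the element and the parameters follow, whereas
  equality of types places the varying tuple first and the parameters last. A permutation of all
  variables, bound ones included, mediates between the two conventions without capture.\<close>

fun rename_trm :: "(nat \<Rightarrow> nat) \<Rightarrow> 'f trm \<Rightarrow> 'f trm" where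
  "rename_trm \<rho> (Var v) = Var (\<rho> v)"
| "rename_trm \<rho> (Fun f ts) = Fun f (map (rename_trm \<rho>) ts)"

fun rename :: "(nat \<Rightarrow> nat) \<Rightarrow> ('f, 'r) fm \<Rightarrow> ('f, 'r) fm" where
  "rename \<rho> Fls = Fls"
| "rename \<rho> (Eq s t) = Eq (rename_trm \<rho> s) (rename_trm \<rho> t)"
| "rename \<rho> (Rel R ts) = Rel R (map (rename_trm \<rho>) ts)"
| "rename \<rho> (Neg \<phi>) = Neg (rename \<rho> \<phi>)"
| "rename \<rho> (Conj \<phi> \<psi>) = Conj (rename \<rho> \<phi>) (rename \<rho> \<psi>)"
| "rename \<rho> (Forall v \<phi>) = Forall (\<rho> v) (rename \<rho> \<phi>)"

lemma fv_rename_trm: "fv_trm (rename_trm \<rho> t) = \<rho> ` fv_trm t"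
  by (induction t) auto

lemma fv_rename: "inj \<rho> \<Longrightarrow> fv (rename \<rho> \<phi>) = \<rho> ` fv \<phi>"
  by (induction \<phi>) (auto simp: fv_rename_trm image_Un image_UN inj_on_image_set_diff[of _ UNIV] dest: injD)

lemma wf_rename_trm: "wf_trm L (rename_trm \<rho> t) \<longleftrightarrow> wf_trm L t"
  by (induction t) auto

lemma wf_rename: "wf_fm L (rename \<rho> \<phi>) \<longleftrightarrow> wf_fm L \<phi>"
  by (induction \<phi>) (auto simp: wf_rename_trm)

lemma val_rename_trm: "val M e (rename_trm \<rho> t) = val M (e \<circ> \<rho>) t"
proof (induction t)
  case (Fun f ts)
  have "map (val M e \<circ> rename_trm \<rho>) ts = map (val M (e \<circ> \<rho>)) ts"
    by (rule map_cong) (use Fun.IH in \<open>simp_all add: comp_def\<close>)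
  then show ?case by (metis rename_trm.simps(2) val.simps(2) map_map)
qed simp

lemma sat_rename: "inj \<rho> \<Longrightarrow> sat M e (rename \<rho> \<phi>) \<longleftrightarrow> sat M (e \<circ> \<rho>) \<phi>"
proof (induction \<phi> arbitrary: e)
  case (Rel R ts)
  have "map (val M e) (map (rename_trm \<rho>) ts) = map (val M (e \<circ> \<rho>)) ts"
    unfolding map_map by (rule map_cong) (simp_all add: val_rename_trm comp_def)
  then show ?case by (metis rename.simps(3) sat.simps(3))
next
  case (Forall v \<phi>)
  have "e(\<rho> v := a) \<circ> \<rho> = (e \<circ> \<rho>)(v := a)" for a
    using Forall.prems by (auto simp: fun_eq_iff dest: injD)
  then show ?case by (simp only: rename.simps sat.simps Forall.IH[OF Forall.prems])
qed (auto simp: val_rename_trm)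

lemma psat_same_type:
  assumes \<phi>: "(\<phi>, as) \<in> formulas_over L U" and d: "d \<in> A" and same: "same_type L C A bs as"
  shows "psat C d (\<phi>, bs) \<longleftrightarrow> psat C d (\<phi>, as)"
proof -
  let ?n = "length as"
  \<comment> \<open>A cyclic shift of \<open>0, \<dots>, ?n\<close>, so that the parameters come first; the variables beyond are fixed.\<close>
  define \<rho> where "\<rho> = (\<lambda>v. case v of 0 \<Rightarrow> ?n | Suc i \<Rightarrow> if i < ?n then i else Suc i)"
  have inj: "inj \<rho>" by (rule injI) (auto simp: \<rho>_def split: nat.splits if_splits)
  have len: "length bs = ?n" using same by (simp add: same_type_def)
  have fv: "fv \<phi> \<subseteq> {..?n}" and wf: "wf_fm L \<phi>" using \<phi> by (auto simp: formulas_over_def)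
  have \<rho>: "\<rho> v < Suc ?n" if "v \<le> ?n" for v using that by (auto simp: \<rho>_def split: nat.splits)
  have "sat C (\<lambda>i. (xs @ [d]) ! i) (rename \<rho> \<phi>) \<longleftrightarrow> psat C d (\<phi>, xs)" if "length xs = ?n" for xs
  proof -
    have "sat C ((\<lambda>i. (xs @ [d]) ! i) \<circ> \<rho>) \<phi> \<longleftrightarrow> sat C (\<lambda>i. (d # xs) ! i) \<phi>"
    proof (rule sat_cong)
      fix v assume "v \<in> fv \<phi>"
      then have "v \<le> ?n" using fv by auto
      then show "((\<lambda>i. (xs @ [d]) ! i) \<circ> \<rho>) v = (d # xs) ! v"
        using that by (cases v) (auto simp: \<rho>_def nth_append)
    qed
    then show ?thesis by (simp add: psat_def sat_rename[OF inj])
  qed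
  moreover have "fv (rename \<rho> \<phi>) \<subseteq> {..<length bs + length [d]}"
    using \<rho> fv len by (auto simp: fv_rename[OF inj] subset_iff)
  then have "sat C (\<lambda>i. (bs @ [d]) ! i) (rename \<rho> \<phi>) \<longleftrightarrow> sat C (\<lambda>i. (as @ [d]) ! i) (rename \<rho> \<phi>)"
    using same d wf unfolding same_type_def by (simp add: wf_rename)
  ultimately show ?thesis using len by simp
qed

text \<open>If \<open>d\<close> in \<open>A\<close> satisfies a formula \<open>\<phi>(x, a)\<close>, it also satisfies \<open>\<phi>(x, b)\<close> for every \<open>b\<close> with
  the type of \<open>a\<close> over \<open>A\<close>, so no family of such instances is inconsistent.\<close>

lemma not_psat_divides:
  fixes C :: "('f, 'r, 'a) struct"
  assumes "\<psi> \<in> formulas_over L U" "d \<in> A" "d \<in> univ C" "divides L C A \<psi>"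
  shows "\<not> psat C d \<psi>"
proof
  obtain \<phi> as where \<psi>: "\<psi> = (\<phi>, as)" by fastforce
  assume d: "psat C d \<psi>"
  obtain k :: nat and b :: "nat \<Rightarrow> 'a list" where b: "\<forall>i. set (b i) \<subseteq> univ C \<and> same_type L C A (b i) as"
    "\<forall>I. finite I \<and> card I = k \<longrightarrow> \<not> (\<exists>d. realizes C d ((\<lambda>i. (\<phi>, b i)) ` I))"
    using assms(4) unfolding divides_def \<psi> fst_conv snd_conv by blast
  have "psat C d (\<phi>, b i)" for i
    using psat_same_type[OF assms(1)[unfolded \<psi>] assms(2), of C "b i"] b(1) d \<psi> by simp
  then have "realizes C d ((\<lambda>i. (\<phi>, b i)) ` {..<k})" using assms(3) by (simp add: realizes_def)
  then show False using b(2)[rule_format, of "{..<k}"] by auto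
qed

lemma monster_infinite:
  assumes "monster_model L \<kappa> C" shows "infinite (Field \<kappa>)"
proof
  assume fin: "finite (Field \<kappa>)"
  have \<kappa>: "Card_order \<kappa>" "(card_of {\<phi>. wf_fm L \<phi>}, \<kappa>) \<in> ordLess"
    using assms by (auto simp: monster_model_def small_def)
  have "(card_of {\<phi>. wf_fm L \<phi>}, card_of (Field \<kappa>)) \<in> ordLeq"
    using ordLess_imp_ordLeq[OF \<kappa>(2)] ordIso_symmetric[OF card_of_Field_ordIso[OF \<kappa>(1)]]
    by (rule ordLeq_ordIso_trans)
  then have "finite {\<phi>. wf_fm L \<phi>}" using fin by (rule card_of_ordLeq_finite)
  then have "finite (range (\<lambda>v. Eq (Var v) (Var v) :: ('a, 'b) fm))"
    by (rule rev_finite_subset) auto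
  then have "finite (UNIV :: nat set)" by (rule finite_imageD) (simp add: inj_on_def)
  then show False by simp
qed

lemma small_Un_finite:
  assumes "monster_model L \<kappa> C" "small \<kappa> A" "finite B" shows "small \<kappa> (A \<union> B)"
proof -
  have \<kappa>: "Card_order \<kappa>" "infinite (Field \<kappa>)"
    using assms(1) monster_infinite by (auto simp: monster_model_def)
  have "small \<kappa> B" unfolding small_def
    by (rule finite_ordLess_infinite) (use \<kappa> assms(3) in \<open>auto simp: Field_card_of card_of_well_order_on card_order_on_well_order_on\<close>)
  then show ?thesis using card_of_Un_ordLess_infinite_Field[OF \<kappa>(2,1)] assms(2) by (simp add: small_def)
qed

text \<open>If \<open>p\<close> forked, it would imply a disjunction of finitely many formulas dividing over \<open>A\<close>. No
  element of \<open>A\<close> satisfies any of these, so \<open>p\<close> together with their negations is still finitely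
  satisfiable in \<open>A\<close>; by saturation it is realized, a contradiction.\<close>

lemma not_forks_if_finitely_satisfiable:
  fixes C :: "('f, 'r, 'a) struct"
  assumes C: "monster_model L \<kappa> C" and A: "A \<subseteq> univ C"
    and p: "p \<subseteq> formulas_over L A'" "A' \<subseteq> univ C" "small \<kappa> A'"
    and fs: "finitely_satisfiable_in C A p"
  shows "\<not> forks L C A p"
proof
  assume "forks L C A p"
  then obtain \<Psi> where \<Psi>: "finite \<Psi>" "\<Psi> \<subseteq> formulas_over L (univ C)"
    "\<And>\<psi>. \<psi> \<in> \<Psi> \<Longrightarrow> divides L C A \<psi>"
    "\<And>d. realizes C d p \<Longrightarrow> \<exists>\<psi>\<in>\<Psi>. psat C d \<psi>"
    unfolding forks_def by blast
  define P where "P = (\<Union>\<psi>\<in>\<Psi>. set (snd \<psi>))"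
  define neg :: "('f, 'r, 'a) pfm \<Rightarrow> ('f, 'r, 'a) pfm" where "neg = (\<lambda>\<psi>. (Neg (fst \<psi>), snd \<psi>))"
  have neg: "psat C d (neg \<psi>) \<longleftrightarrow> \<not> psat C d \<psi>" for d \<psi> by (simp add: psat_def neg_def)
  have P: "P \<subseteq> univ C" "finite P"
    using \<Psi>(1) subsetD[OF \<Psi>(2)] by (fastforce simp: P_def formulas_over_def)+
  have "partial_type L C (A' \<union> P) (p \<union> neg ` \<Psi>)"
    unfolding partial_type_def finitely_satisfiable_in_def
  proof (intro conjI allI impI)
    have "p \<subseteq> formulas_over L (A' \<union> P)" using p(1) by (auto simp: formulas_over_def)
    moreover have "neg ` \<Psi> \<subseteq> formulas_over L (A' \<union> P)"
      using subsetD[OF \<Psi>(2)] by (fastforce simp: formulas_over_def neg_def P_def)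
    ultimately show "p \<union> neg ` \<Psi> \<subseteq> formulas_over L (A' \<union> P)" by simp
    fix p0 assume p0: "p0 \<subseteq> p \<union> neg ` \<Psi>" "finite p0"
    then obtain d where d: "d \<in> A" "realizes C d (p0 \<inter> p)"
      using fs unfolding finitely_satisfiable_in_def by (meson finite_Int inf_le2)
    have "\<not> psat C d \<psi>" if "\<psi> \<in> \<Psi>" for \<psi>
      using not_psat_divides[of \<psi> L "univ C" d A C] \<Psi>(2,3) that d(1) A by blast
    then have "psat C d \<psi>" if "\<psi> \<in> p0" for \<psi> using p0(1) d(2) that neg by (auto simp: realizes_def)
    then have "realizes C d p0" using d(1) A unfolding realizes_def by blast
    then show "\<exists>d\<in>univ C. realizes C d p0" using d(1) A by blast
  qed
  moreover have "small \<kappa> (A' \<union> P)" by (rule small_Un_finite[OF C p(3) P(2)])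
  ultimately obtain d where d: "realizes C d (p \<union> neg ` \<Psi>)"
    using C p(2) P(1) unfolding monster_model_def saturated_def by (meson Un_least)
  then have "realizes C d p" by (auto simp: realizes_def)
  then obtain \<psi> where "\<psi> \<in> \<Psi>" "psat C d \<psi>" using \<Psi>(4) by blast
  then show False using d neg unfolding realizes_def by blast
qed

section \<open>Realizing the type over a branch inside the branch\<close>

lemma branchD:
  assumes "branch M B"
  shows "B \<subseteq> univ M"
    and "\<And>x y. \<lbrakk>x \<in> B; y \<in> B\<rbrakk> \<Longrightarrow> leq M x y \<or> leq M y x \<or> x = y"
    and "\<And>S. \<lbrakk>S \<subseteq> univ M; \<And>x y. \<lbrakk>x \<in> S; y \<in> S\<rbrakk> \<Longrightarrow> leq M x y \<or> leq M y x\<rbrakk> \<Longrightarrow> \<not> B \<subset> S"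
proof -
  have B: "pred_on.chain (univ M) (leq M) B"
    and max: "\<nexists>S. pred_on.chain (univ M) (leq M) S \<and> B \<subset> S"
    using assms unfolding branch_def pred_on.maxchain_def by (rule conjunct1, rule conjunct2)
  show "B \<subseteq> univ M" "\<And>x y. \<lbrakk>x \<in> B; y \<in> B\<rbrakk> \<Longrightarrow> leq M x y \<or> leq M y x \<or> x = y"
    using B by (auto simp: pred_on.chain_def)
  show "\<not> B \<subset> S"
    if "S \<subseteq> univ M" "\<And>x y. \<lbrakk>x \<in> S; y \<in> S\<rbrakk> \<Longrightarrow> leq M x y \<or> leq M y x" for S
  proof
    assume "B \<subset> S"
    moreover have "pred_on.chain (univ M) (leq M) S" using that unfolding pred_on.chain_def by blast
    ultimately show False using max by blast
  qed
qed

lemma branch_nonempty: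
  assumes "branch M B" "a \<in> univ M" "leq M a a" shows "B \<noteq> {}"
  using branchD(3)[OF assms(1), of "{a}"] assms(2,3) by auto

context star_model
begin

text \<open>If the whole branch were below some \<open>m\<close>, a point strictly above \<open>m\<close> could be added to it. The
  branch is linearly ordered, so it suffices to escape the elements of \<open>S\<close> one at a time.\<close>

lemma branch_cofinal:
  assumes M: "univ M \<subseteq> univ C" "\<And>x y. x \<in> univ M \<Longrightarrow> y \<in> univ M \<Longrightarrow> leq M x y \<longleftrightarrow> leq C x y"
    and B: "branch M B"
    and no_max: "\<And>m. m \<in> univ M \<Longrightarrow> \<exists>m'\<in>univ M. leq C m m' \<and> m \<noteq> m'"
    and S: "finite S" "S \<subseteq> univ M" and ne: "univ M \<noteq> {}"
  shows "\<exists>b\<in>B. \<forall>s\<in>S. \<not> leq C b s"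
proof -
  note B_M = branchD(1)[OF B]
  have lin: "leq C x y \<or> leq C y x" if "x \<in> B" "y \<in> B" for x y
    using branchD(2)[OF B that] M that B_M refl[of x] by blast
  have U: "x \<in> univ C" if "x \<in> univ M" for x using that M(1) by blast
  have one: "\<exists>b\<in>B. \<not> leq C b m" if m: "m \<in> univ M" for m
  proof (rule ccontr)
    assume "\<not> ?thesis"
    then have b_m: "leq C b m" if "b \<in> B" for b using that by blast
    obtain m' where m': "m' \<in> univ M" "leq C m m'" "m \<noteq> m'" using no_max[OF m] by blast
    have b_m': "leq C b m'" if "b \<in> B" for b
      using trans[OF _ _ _ b_m[OF that] m'(2)] U m m'(1) subsetD[OF B_M that] by blast
    have "\<not> B \<subset> insert m' B"
    proof (rule branchD(3)[OF B])
      show I: "insert m' B \<subseteq> univ M" using B_M m'(1) by simp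
      fix x y assume "x \<in> insert m' B" "y \<in> insert m' B"
      moreover from this have "leq C x y \<or> leq C y x"
        using lin b_m' refl[OF U[OF m'(1)]] by blast
      ultimately show "leq M x y \<or> leq M y x" using M(2) I by blast
    qed
    then have "m' \<in> B" by blast
    then show False using antisym[OF U[OF m] U[OF m'(1)] m'(2)] b_m m'(3) by blast
  qed
  show ?thesis using S
  proof (induction S)
    case empty
    then show ?case using one ne by blast
  next
    case (insert s S)
    then obtain b1 b2 where b: "b1 \<in> B" "\<forall>s\<in>S. \<not> leq C b1 s" "b2 \<in> B" "\<not> leq C b2 s"
      using one[of s] by auto
    have tr: "\<not> leq C b t" if "leq C b' b" "\<not> leq C b' t" "b \<in> B" "b' \<in> B" "t \<in> univ M" for b b' t
      using trans[OF U U U, of b' b t] that B_M by blast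
    have "leq C b1 b2 \<or> leq C b2 b1" using lin b by blast
    then show ?case
    proof
      assume "leq C b1 b2"
      then show ?thesis using b tr[of b1 b2] insert.prems by (intro bexI[of _ b2]) auto
    next
      assume "leq C b2 b1"
      then show ?thesis using b tr[of b2 b1] insert.prems by (intro bexI[of _ b1]) auto
    qed
  qed
qed

end

theorem proposition4p20:
  fixes L :: "(tree_fun, 'r) lang"
    and T :: "(tree_fun, 'r) fm set"
    and F :: "(tree_fun, 'r star_sym, 'b) struct"
    and M C :: "(tree_fun, 'r star_sym, 'a) struct"
    and \<kappa> :: "'k rel"
    and B :: "'a set"
    and q :: "(tree_fun, 'r star_sym, 'a) pfm set"
    and c :: 'a
  assumes "finite_relational L"
    and "universal_theory L T"
    and "fraisse_class L (finite_models L T)"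
    and "SAP L (finite_models L T)"
    and "fraisse_limit (star_lang L) (finite_models (star_lang L) (star_theory L T)) F"
    and "models (star_lang L) M (theory_of (star_lang L) F)"
    and "monster_model (star_lang L) \<kappa> C"
    and "elementary_substructure (star_lang L) M C"
    and "small \<kappa> (univ M)"
    and "branch M B"
    and "complete_type (star_lang L) C (univ M) q"
    and "above ` B \<subseteq> q"
    and "realizes C c q"
  shows "\<not> forks (star_lang L) C (univ M) (q \<union> {below c}) \<and>
    finitely_satisfiable_in C (univ M) (q \<union> {below c}) \<and>
    finitely_satisfiable_in C B (q \<union> {below c})"
proof -
  let ?L = "star_lang L"
  have C: "is_struct ?L C" using assms(7) by (simp add: monster_model_def)
  have F: "is_struct ?L F" "ultrahomogeneous ?L F" using assms(5) by (auto simp: fraisse_limit_def)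
  have FC: "elem_equiv ?L F C" by (rule elem_equiv_theory_of[OF F(1) assms(6,8)])
  interpret star_model L C by (rule star_model_of_fraisse_limit[OF assms(5) C FC assms(1)])
  have emb: "embedding ?L M C id" and M_struct: "is_struct ?L M"
    using assms(8) by (auto simp: elementary_substructure_def substructure_def)
  have M_C: "univ M \<subseteq> univ C" using emb by (auto simp: embedding_def)
  have M_leq: "leq M x y \<longleftrightarrow> leq C x y" if "x \<in> univ M" "y \<in> univ M" for x y
    using emb[unfolded embedding_def] that rel_ar_star_lang(1)[of L] by (auto dest!: spec[of _ "[x, y]"] spec[of _ Leq])
  note B_M = branchD(1)[OF assms(10)]
  have M_ne: "univ M \<noteq> {}" using M_struct by (simp add: is_struct_def)
  have c: "c \<in> univ C" using assms(13) by (simp add: realizes_def)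
  have c_above: "leq C b c \<and> b \<noteq> c" if "b \<in> B" for b
  proof -
    have "psat C c (above b)" using assms(12,13) that by (auto simp: realizes_def)
    then show ?thesis by (simp add: psat_def above_def)
  qed
  note invariance = sat_partial_isomorphism[OF finite_star_lang[OF assms(1)] F C FC locally_finite_star]
  have B_ne: "B \<noteq> {}"
  proof -
    obtain a where "a \<in> univ M" using M_ne by blast
    then show ?thesis using branch_nonempty[OF assms(10)] M_leq[of a a] refl[of a] M_C by auto
  qed
  \<comment> \<open>Some \<open>b\<close> lies strictly below \<open>c\<close>, and all points have the same type over the empty set.\<close>
  have no_max: "\<exists>m'\<in>univ M. leq C m m' \<and> m \<noteq> m'" if m: "m \<in> univ M" for m
  proof -
    let ?lt = "Lt (Var 0) (Var 1) :: (tree_fun, 'r star_sym) fm"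
    let ?\<phi> = "Neg (Forall 1 (Neg ?lt))"
    obtain b where b: "b \<in> B" using B_ne by blast
    then have bU: "b \<in> univ C" using B_M M_C by blast
    have mU: "m \<in> univ C" using m M_C by blast
    have "sat C (\<lambda>_. b) ?\<phi>" using c_above[OF b] c by auto
    moreover have "sat C (\<lambda>_. b) ?\<phi> \<longleftrightarrow> sat C ((\<lambda>_. m) \<circ> (\<lambda>_. b)) ?\<phi>"
    proof (rule invariance[OF _ _ _ _ embedding_singleton[OF bU mU]])
      show "closed_under ?L C {b}" using mt_idem[OF bU] by (simp add: closed_under_star_lang)
    qed (use bU in \<open>auto simp: rel_ar_star_lang\<close>)
    ultimately have "sat C (\<lambda>_. m) ?\<phi>" by (simp add: comp_def)
    moreover have "sat M (\<lambda>_. m) ?\<phi> \<longleftrightarrow> sat C (\<lambda>_. m) ?\<phi>"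
    proof -
      have "wf_fm ?L ?\<phi>" by (simp add: rel_ar_star_lang)
      moreover have "range (\<lambda>_ :: nat. m) \<subseteq> univ M" using m by auto
      ultimately show ?thesis using assms(8) unfolding elementary_substructure_def by blast
    qed
    ultimately obtain m' where "m' \<in> univ M" "leq M m m'" "m \<noteq> m'" by auto
    then show ?thesis using M_leq[OF m] by auto
  qed
  have q: "q \<subseteq> formulas_over ?L (univ M)"
    using assms(11) by (simp add: complete_type_def partial_type_def)
  have fs_B: "finitely_satisfiable_in C B (q \<union> {below c})"
    unfolding finitely_satisfiable_in_def
  proof (intro allI impI)
    fix p0 assume p0: "p0 \<subseteq> q \<union> {below c}" "finite p0"
    define S where "S = (\<Union>\<psi>\<in>p0 \<inter> q. set (snd \<psi>))"
    have S: "finite S" "S \<subseteq> univ M" using p0(2) subsetD[OF q] by (fastforce simp: S_def formulas_over_def)+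
    obtain b where b: "b \<in> B" "\<forall>s\<in>S. \<not> leq C b s"
      using branch_cofinal[OF M_C M_leq assms(10) no_max S M_ne] by blast
    have bU: "b \<in> univ C" using b(1) B_M M_C by blast
    obtain D where D: "finite D" "S \<subseteq> D" "D \<subseteq> univ C" "mt_closed D" "\<And>d. d \<in> D \<Longrightarrow> \<exists>s\<in>S. leq C d s"
      using finite_mt_closed_hull[of S] S M_C by blast
    have D_b: "\<not> leq C b d" if d: "d \<in> D" for d
    proof -
      obtain s where s: "s \<in> S" "leq C d s" using D(5)[OF d] by blast
      then have "d \<in> univ C" "s \<in> univ C" using d D(3) S(2) M_C by auto
      then show ?thesis using trans[OF bU, of d s] s b(2) by blast
    qed
    define E where "E = D \<union> inf_of C b ` D"
    have E: "E \<subseteq> univ C" "mt_closed (insert b E)" "finite E"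
      using D(1,3) mt_in[OF bU] mt_closed_adjoin[OF D(4,3) bU] by (auto simp: E_def)
    have E_b: "\<not> leq C b d" if "d \<in> E" for d
      using that D_b D(3) bU le_mt_iff[OF bU _ bU] by (auto simp: E_def)
    have emb_bc: "embedding ?L (C\<lparr>univ := insert b E\<rparr>) C (id(b := c))"
      using embedding_move_top[OF E(1,2) bU c] c_above[OF b(1)] E_b by blast
    have "psat C b \<psi>" if \<psi>: "\<psi> \<in> p0" for \<psi>
    proof (cases "\<psi> = below c")
      case True
      then show ?thesis using c_above[OF b(1)] by (simp add: psat_def below_def)
    next
      case False
      then have \<psi>_q: "\<psi> \<in> q" using p0(1) \<psi> by blast
      obtain \<phi> as where \<psi>_eq: "\<psi> = (\<phi>, as)" by fastforce
      have \<phi>: "wf_fm ?L \<phi>" "fv \<phi> \<subseteq> {..length as}"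
        using subsetD[OF q \<psi>_q] by (auto simp: \<psi>_eq formulas_over_def)
      have as_S: "set as \<subseteq> S" using \<psi> \<psi>_q by (auto simp: S_def \<psi>_eq)
      have val_E: "((b # as) ! v) \<in> insert b E" if "v \<in> fv \<phi>" for v
      proof (cases v)
        case (Suc i)
        then have "i < length as" using that \<phi>(2) by auto
        then have "as ! i \<in> D" using as_S D(2) nth_mem by blast
        then show ?thesis using Suc by (simp add: E_def)
      qed simp
      have "sat C (\<lambda>i. (b # as) ! i) \<phi> \<longleftrightarrow> sat C (id(b := c) \<circ> (\<lambda>i. (b # as) ! i)) \<phi>"
        by (rule invariance[OF _ _ _ _ emb_bc \<phi>(1) val_E])
          (use E bU in \<open>auto simp: closed_under_star_lang mt_closed_def\<close>)
      also have "\<dots> \<longleftrightarrow> sat C (\<lambda>i. (c # as) ! i) \<phi>"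
      proof (rule sat_cong)
        fix v assume v: "v \<in> fv \<phi>"
        show "(id(b := c) \<circ> (\<lambda>i. (b # as) ! i)) v = (c # as) ! v"
        proof (cases v)
          case (Suc i)
          then have "i < length as" using v \<phi>(2) by auto
          then have "as ! i \<in> S" using as_S nth_mem by blast
          then have "as ! i \<noteq> b" using b(2) refl[OF bU] by auto
          then show ?thesis using Suc by simp
        qed simp
      qed
      finally show ?thesis using assms(13) \<psi>_q by (auto simp: realizes_def psat_def \<psi>_eq)
    qed
    then show "\<exists>d\<in>B. realizes C d p0" using b(1) bU by (auto simp: realizes_def)
  qed
  then have fs_M: "finitely_satisfiable_in C (univ M) (q \<union> {below c})"
    using B_M unfolding finitely_satisfiable_in_def by blast
  have "\<not> forks ?L C (univ M) (q \<union> {below c})"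
  proof (rule not_forks_if_finitely_satisfiable[OF assms(7) M_C _ _ _ fs_M])
    show "q \<union> {below c} \<subseteq> formulas_over ?L (univ M \<union> {c})"
      using subsetD[OF q] by (auto simp: formulas_over_def below_def rel_ar_star_lang)
    show "univ M \<union> {c} \<subseteq> univ C" using M_C c by simp
    show "small \<kappa> (univ M \<union> {c})" by (rule small_Un_finite[OF assms(7,9)]) simp
  qed
  then show ?thesis using fs_M fs_B by blast
qed

end
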